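(* Let $k\ge1$ be an integer, and for nonnegative integers $n_1,\dots,n_k$ put $N_i=n_i+n_{i+1}+\cdots+n_k$ for $1\le i\le k$. Then (as formal power series in $q$, and hence also as analytic functions for $|q|<1$) $$\sum_{n_1,\dots,n_k\ge0}\ \sum_{j=0}^{2n_k} \frac{q^{N_1^2+N_2^2+\cdots+N_k^2}\left(\frac{n_k-j+1}{3}\right)}{(q;q)_{2n_k-j}\,(q;q)_{n_1}(q;q)_{n_2}\cdots(q;q)_{n_{k-1}}\,(q;q)_j}=\frac{(q^k,q^{5k},q^{6k};q^{6k})_\infty\,(q^{4k},q^{8k};q^{12k})_\infty}{(q;q)_\infty},$$ where $\left(\frac{m}{3}\right)$ denotes the Legendre symbol modulo $3$ (and the product $(q;q)_{n_1}\cdots(q;q)_{n_{k-1}}$ is empty, equal to $1$, when $k=1$).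
   Context: Notation: $(A;q)_0=1$, $(A;q)_n=(1-A)(1-Aq)\cdots(1-Aq^{n-1})$ for $n\ge 1$, $(A;q)_\infty=\prod_{i=0}^\infty(1-Aq^i)$, and $(A_1,\dots,A_r;q)_s=(A_1;q)_s\cdots(A_r;q)_s$. The Legendre symbol $\left(\frac{m}{3}\right)$ equals $1$, $-1$, $0$ according as $m\equiv 1,\,2,\,0 \pmod 3$ (for every integer $m$, including negative ones). *)

theory Defs
  imports "HOL-Analysis.Analysis" "HOL-Number_Theory.Number_Theory"
begin

text \<open>
  The definitions are polymorphic, so that the same expressions can be read at a complex number
  and at the formal variable \<^term>\<open>fps_X\<close>. Limits of formal power series are
  taken in the library's (X-adic) metric on \<^typ>\<open>'a fps\<close>.
\<close>

definition qpoch :: "'a::comm_ring_1 \<Rightarrow> 'a \<Rightarrow> nat \<Rightarrow> 'a" where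
  "qpoch a q n = (\<Prod>i<n. 1 - a * q ^ i)"

definition qpoch_inf :: "'a::{t2_space,comm_ring_1} \<Rightarrow> 'a \<Rightarrow> 'a" where
  "qpoch_inf a q = (\<Prod>i. 1 - a * q ^ i)"

definition qpochs_inf :: "'a::{t2_space,comm_ring_1} list \<Rightarrow> 'a \<Rightarrow> 'a" where
  "qpochs_inf as q = (\<Prod>a\<leftarrow>as. qpoch_inf a q)"

definition tail_sum :: "nat \<Rightarrow> (nat \<Rightarrow> nat) \<Rightarrow> nat \<Rightarrow> nat" where
  "tail_sum k n i = (\<Sum>l=i..k. n l)"

definition multisum_term :: "nat \<Rightarrow> 'a::{comm_ring_1,inverse} \<Rightarrow> (nat \<Rightarrow> nat) \<Rightarrow> nat \<Rightarrow> 'a" where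
  "multisum_term k q n j =
     q ^ (\<Sum>i=1..k. (tail_sum k n i)\<^sup>2) * of_int (Legendre (int (n k) - int j + 1) 3) /
     (qpoch q q (2 * n k - j) * (\<Prod>i=1..<k. qpoch q q (n i)) * qpoch q q j)"

definition product_side :: "nat \<Rightarrow> 'a::{t2_space,comm_ring_1,inverse} \<Rightarrow> 'a" where
  "product_side k q =
     qpochs_inf [q ^ k, q ^ (5 * k), q ^ (6 * k)] (q ^ (6 * k)) *
     qpochs_inf [q ^ (4 * k), q ^ (8 * k)] (q ^ (12 * k)) /
     qpoch_inf q q"

end

theory Submission
  imports Defs
begin

text \<open>
  The substitution \<open>j = n\<^sub>k - r\<close> in the inner sum shows what the identity is about: with
  \<open>\<beta>\<^sub>n = (\<Sum>r=-n..n. (r+1 | 3) / ((q;q)\<^sub>n\<^sub>-\<^sub>r (q;q)\<^sub>n\<^sub>+\<^sub>r))\<close>, where \<open>(\<sqdot> | 3)\<close> is the Legendre symbol, the left-hand side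
  is the \<open>k\<close>-fold iterate of the Bailey lemma (with parameter \<open>a = 1\<close>) applied to \<open>\<beta>\<close>. Each step multiplies the
  coefficient of index \<open>r\<close> by \<open>q\<^bsup>r\<^sup>2\<^esup>\<close>, so the multisum equals
  \<open>(\<Sum>r. (r+1 | 3) q\<^bsup>k r\<^sup>2\<^esup>) / (q;q)\<^sub>\<infinity>\<close>, summed over all integers.

  Only the part of \<open>(r+1 | 3)\<close> that is even in \<open>r\<close> matters, and it agrees with that of \<open>\<omega>\<^sup>r\<close>, \<open>\<omega>\<close> a primitive
  cube root of unity. Hence the numerator is the theta series \<open>\<Sum>r. \<omega>\<^sup>r Q\<^bsup>r\<^sup>2\<^esup>\<close> at \<open>Q = q\<^sup>k\<close>, which Jacobi's
  triple product factors as \<open>\<Prod>n\<ge>1. (1 - Q\<^bsup>2n\<^esup>) (1 - Q\<^bsup>2n-1\<^esup> + Q\<^bsup>4n-2\<^esup>)\<close>. Because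
  \<open>(1 - x + x\<^sup>2) (1 + x) = 1 + x\<^sup>3\<close>, this is a quotient of \<open>q\<close>-shifted factorials, and sorting exponents
  by residue classes brings it to the form on the right-hand side.

  Both ingredients are proved as finite identities, valid in every commutative ring: \<open>bailey_chain\<close>
  truncates the multisum by \<open>N\<^sub>1 \<le> M\<close>, and \<open>finite_triple_product\<close> has finitely many factors. Then \<open>M\<close> tends to
  infinity by Tannery's theorem (\<open>tannery_has_sum\<close>, \<open>tannery_tendsto\<close>). The passage to the limit uses only a complete
  submultiplicative absolute value in which \<open>1 - x\<close> is a unit for all small \<open>x\<close>, so one proof serves for complex numbers and
  for formal power series with the \<open>X\<close>-adic absolute value.
\<close>

section \<open>Gaussian binomial coefficients\<close>

fun gauss_binom :: "'a::comm_ring_1 \<Rightarrow> nat \<Rightarrow> nat \<Rightarrow> 'a" where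
  "gauss_binom p n 0 = 1"
| "gauss_binom p 0 (Suc k) = 0"
| "gauss_binom p (Suc n) (Suc k) = p ^ (n - k) * gauss_binom p n k + gauss_binom p n (Suc k)"

lemma gauss_binom_eq_0: "n < k \<Longrightarrow> gauss_binom p n k = 0"
  by (induction p n k rule: gauss_binom.induct) auto

lemma gauss_binom_absorb_from_ratio:
  assumes "(1 - p ^ Suc k) * gauss_binom p n (Suc k) = (1 - p ^ (n - k)) * gauss_binom p n k"
  shows "(1 - p ^ Suc k) * gauss_binom p (Suc n) (Suc k) = (1 - p ^ Suc n) * gauss_binom p n k"
proof (cases "k \<le> n")
  case True
  then have "p ^ (n - k) * p ^ Suc k = p ^ Suc n"
    by (simp flip: power_add del: power_Suc)
  moreover have "(1 - p ^ Suc k) * gauss_binom p (Suc n) (Suc k) =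
      p ^ (n - k) * (1 - p ^ Suc k) * gauss_binom p n k + (1 - p ^ Suc k) * gauss_binom p n (Suc k)"
    by (simp add: algebra_simps)
  moreover have "\<dots> = (1 - p ^ (n - k) * p ^ Suc k) * gauss_binom p n k"
    unfolding assms by (simp add: algebra_simps)
  ultimately show ?thesis
    by (simp only:)
qed (simp add: gauss_binom_eq_0)

text \<open>
  Both expressions equal \<open>(p;p)\<^sub>n / ((p;p)\<^sub>k (p;p)\<^sub>n\<^sub>-\<^sub>k\<^sub>-\<^sub>1)\<close> when the factors are invertible and \<open>k < n\<close>. Stating the relation
  without division makes it valid in every commutative ring; the second \<open>q\<close>-Pascal rule
  and the quotient formula both follow from it.
\<close>

lemma gauss_binom_ratio:
  "(1 - p ^ Suc k) * gauss_binom p n (Suc k) = (1 - p ^ (n - k)) * gauss_binom p n k"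
proof (induction n arbitrary: k)
  case (Suc n)
  have "(1 - p ^ (Suc n - k)) * gauss_binom p (Suc n) k = (1 - p ^ Suc n) * gauss_binom p n k"
  proof (cases k)
    case (Suc l)
    have "(1 - p ^ (n - l)) * gauss_binom p (Suc n) (Suc l) =
        p ^ (n - l) * ((1 - p ^ (n - l)) * gauss_binom p n l) + (1 - p ^ (n - l)) * gauss_binom p n (Suc l)"
      by (simp add: algebra_simps)
    also have "\<dots> = p ^ (n - l) * ((1 - p ^ Suc l) * gauss_binom p n (Suc l)) + (1 - p ^ (n - l)) * gauss_binom p n (Suc l)"
      by (simp only: Suc.IH)
    also have "\<dots> = (1 - p ^ (n - l) * p ^ Suc l) * gauss_binom p n (Suc l)"
      by (simp add: algebra_simps)
    also have "\<dots> = (1 - p ^ Suc n) * gauss_binom p n (Suc l)"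
      by (cases "l < n") (simp_all add: gauss_binom_eq_0 flip: power_add power_Suc)
    finally show ?thesis by (simp add: Suc)
  qed simp
  with gauss_binom_absorb_from_ratio[OF Suc.IH] show ?case by simp
qed simp

text \<open>
  The second \<open>q\<close>-Pascal rule. The triple product needs both rules: one to lengthen the product in
  \<open>z\<close>, the other to lengthen the product in \<open>1/z\<close>.
\<close>

lemma gauss_binom_Suc_Suc':
  "gauss_binom p (Suc n) (Suc k) = gauss_binom p n k + p ^ Suc k * gauss_binom p n (Suc k)"
  using gauss_binom_ratio[of p k n] by (simp add: algebra_simps)

lemmas gauss_binom_absorb = gauss_binom_absorb_from_ratio[OF gauss_binom_ratio]

lemma qpoch_0 [simp]: "qpoch a q 0 = 1"
  and qpoch_Suc: "qpoch a q (Suc n) = qpoch a q n * (1 - a * q ^ n)"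
  by (simp_all add: qpoch_def)

lemma qpoch_add: "qpoch a q (m + n) = qpoch a q m * qpoch (a * q ^ m) q n"
  by (induction n) (simp_all add: qpoch_Suc power_add mult.assoc)

lemma gauss_binom_qpoch:
  "k \<le> n \<Longrightarrow> qpoch p p k * qpoch p p (n - k) * gauss_binom p n k = qpoch p p n"
proof (induction k arbitrary: n)
  case (Suc k)
  then obtain n' where n: "n = Suc n'" "k \<le> n'"
    by (cases n) auto
  have "qpoch p p (Suc k) * qpoch p p (n' - k) * gauss_binom p (Suc n') (Suc k)
      = qpoch p p k * qpoch p p (n' - k) * ((1 - p ^ Suc k) * gauss_binom p (Suc n') (Suc k))"
    by (simp only: qpoch_Suc power_Suc ac_simps)
  also have "\<dots> = (1 - p ^ Suc n') * (qpoch p p k * qpoch p p (n' - k) * gauss_binom p n' k)"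
    by (subst gauss_binom_absorb) (simp only: ac_simps)
  also have "\<dots> = qpoch p p (Suc n')"
    by (simp add: Suc.IH n qpoch_Suc)
  finally show ?case by (simp add: n)
qed simp

text \<open>
  Here and below, \<open>V n\<close> stands for \<open>1/(q;q)\<^sub>n\<close>. Carrying the inverses as a sequence avoids division, so that the
  finite identities hold in every commutative ring where such a sequence exists.
\<close>

lemma gauss_binom_eq_inverses:
  assumes "\<And>n. qpoch p p n * V n = 1" and "k \<le> n"
  shows "gauss_binom p n k = qpoch p p n * V k * V (n - k)"
proof -
  have "qpoch p p n * V k * V (n - k)
      = (qpoch p p k * V k) * (qpoch p p (n - k) * V (n - k)) * gauss_binom p n k"
    by (simp only: ac_simps flip: gauss_binom_qpoch[OF assms(2)])
  then show ?thesis by (simp only: assms(1)) simp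
qed

section \<open>A finite form of Jacobi's triple product\<close>

text \<open>
  The case without factors in \<open>z\<close> is the base of the induction in \<open>finite_triple_product\<close>.
  Writing \<open>z ^ j * w ^ m\<close> for \<open>z\<close> to the power \<open>j - m\<close> keeps all exponents natural.
\<close>

lemma finite_triple_product_right:
  fixes q z w :: "'a::comm_ring_1"
  assumes "z * w = 1"
  shows "(\<Prod>i<m. 1 + w * q ^ (2 * i + 1)) =
    (\<Sum>j\<le>m. gauss_binom (q ^ 2) m j * z ^ j * w ^ m * q ^ (m - j) ^ 2)"
proof (induction m)
  case (Suc m)
  let ?g = "gauss_binom (q ^ 2)"
  have "(\<Prod>i<Suc m. 1 + w * q ^ (2 * i + 1)) =
      (\<Sum>j\<le>m. ?g m j * z ^ j * w ^ m * q ^ (m - j) ^ 2) +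
      (\<Sum>j\<le>m. ?g m j * z ^ j * w ^ Suc m * q ^ ((m - j) ^ 2 + (2 * m + 1)))"
    unfolding prod.lessThan_Suc Suc distrib_left mult_1_right sum_distrib_right
    by (intro arg_cong2[of _ _ _ _ "(+)"] sum.cong refl) (simp only: power_add power_Suc ac_simps)
  also have "(\<Sum>j\<le>m. ?g m j * z ^ j * w ^ Suc m * q ^ ((m - j) ^ 2 + (2 * m + 1))) =
     (\<Sum>j\<le>Suc m. (q^2) ^ j * ?g m j * z ^ j * w ^ Suc m * q ^ (Suc m - j) ^ 2)"
  proof -
    have "q ^ ((m - j) ^ 2 + (2 * m + 1)) = (q^2) ^ j * q ^ (Suc m - j) ^ 2" if j: "j \<le> m" for j
    proof -
      obtain d where "m = j + d" using le_Suc_ex[OF j] by blast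
      then have "(m - j) ^ 2 + (2 * m + 1) = 2 * j + (Suc m - j) ^ 2"
        by (simp add: power2_eq_square Suc_diff_le)
      then show ?thesis
        by (simp only: power_add power_mult)
    qed
    then show ?thesis
      by (simp add: gauss_binom_eq_0 mult.assoc mult.left_commute)
  qed
  also have "(\<Sum>j\<le>m. ?g m j * z ^ j * w ^ m * q ^ (m - j) ^ 2) =
     (\<Sum>j\<le>m. ?g m j * z ^ Suc j * w ^ Suc m * q ^ (m - j) ^ 2)"
  proof (intro sum.cong refl)
    fix j
    have "?g m j * z ^ Suc j * w ^ Suc m * q ^ (m - j) ^ 2 = (z * w) * (?g m j * z ^ j * w ^ m * q ^ (m - j) ^ 2)"
      by (simp only: power_Suc ac_simps)
    then show "?g m j * z ^ j * w ^ m * q ^ (m - j) ^ 2 = ?g m j * z ^ Suc j * w ^ Suc m * q ^ (m - j) ^ 2"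
      by (simp only: assms mult_1_left)
  qed
  also have "\<dots> + (\<Sum>j\<le>Suc m. (q^2) ^ j * ?g m j * z ^ j * w ^ Suc m * q ^ (Suc m - j) ^ 2) =
     (\<Sum>j\<le>Suc m. ?g (Suc m) j * z ^ j * w ^ Suc m * q ^ (Suc m - j) ^ 2)"
    unfolding sum.atMost_Suc_shift gauss_binom_Suc_Suc'
    by (simp add: sum.distrib algebra_simps)
  finally show ?case .
qed simp

text \<open>
  A polynomial form of Jacobi's triple product identity: for \<open>m = n \<rightarrow> \<infinity>\<close> the Gaussian binomials tend
  to \<open>1/(q\<^sup>2;q\<^sup>2)\<^sub>\<infinity>\<close>, and the sum becomes the theta series. Multiplying by the factor number \<open>n\<close> in \<open>z\<close>
  is one application of the \<open>q\<close>-Pascal rule, because the exponents of \<open>q\<close> are the squares of \<open>j - m\<close>.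
\<close>

lemma finite_triple_product:
  fixes q z w :: "'a::comm_ring_1"
  assumes "z * w = 1"
  shows "(\<Prod>i<n. 1 + z * q ^ (2 * i + 1)) * (\<Prod>i<m. 1 + w * q ^ (2 * i + 1)) =
    (\<Sum>j\<le>m+n. gauss_binom (q ^ 2) (m + n) j * z ^ j * w ^ m * q ^ nat ((int j - int m) ^ 2))"
proof (induction n)
  case 0
  have "nat ((int j - int m) ^ 2) = (m - j) ^ 2" if "j \<le> m" for j
    using that by (metis nat_int of_nat_diff of_nat_power power2_commute)
  then have "(\<Sum>j\<le>m. gauss_binom (q ^ 2) m j * z ^ j * w ^ m * q ^ nat ((int j - int m) ^ 2)) =
      (\<Sum>j\<le>m. gauss_binom (q ^ 2) m j * z ^ j * w ^ m * q ^ (m - j) ^ 2)"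
    by (intro sum.cong) auto
  then show ?case
    using finite_triple_product_right[OF assms, where m = m and q = q] by simp
next
  case (Suc n)
  let ?g = "gauss_binom (q ^ 2)" and ?e = "\<lambda>j. nat ((int j - int m) ^ 2)"
  have "(\<Prod>i<Suc n. 1 + z * q ^ (2 * i + 1)) * (\<Prod>i<m. 1 + w * q ^ (2 * i + 1)) =
    (1 + z * q ^ (2 * n + 1)) * ((\<Prod>i<n. 1 + z * q ^ (2 * i + 1)) * (\<Prod>i<m. 1 + w * q ^ (2 * i + 1)))"
    by (simp add: ac_simps)
  also have "\<dots> = (\<Sum>j\<le>Suc (m+n). ?g (m + n) j * z ^ j * w ^ m * q ^ ?e j) +
      (\<Sum>j\<le>m+n. ?g (m + n) j * z ^ Suc j * w ^ m * q ^ (?e j + (2 * n + 1)))"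
    unfolding Suc distrib_right mult_1_left sum_distrib_left sum.distrib
    by (rule arg_cong2[of _ _ _ _ "(+)"], simp add: gauss_binom_eq_0)
       (intro sum.cong refl, simp only: power_add power_Suc ac_simps)
  also have "(\<Sum>j\<le>m+n. ?g (m + n) j * z ^ Suc j * w ^ m * q ^ (?e j + (2 * n + 1))) =
      (\<Sum>j\<le>m+n. (q ^ 2) ^ (m + n - j) * ?g (m + n) j * z ^ Suc j * w ^ m * q ^ ?e (Suc j))"
  proof (intro sum.cong refl)
    fix j assume j: "j \<in> {..m+n}"
    have e: "int (?e i) = (int i - int m) ^ 2" for i
      by simp
    have "int (?e j + (2 * n + 1)) = int (2 * (m + n - j) + ?e (Suc j))"
      unfolding of_nat_add e using j by (simp add: of_nat_diff power2_eq_square algebra_simps)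
    then have "?e j + (2 * n + 1) = 2 * (m + n - j) + ?e (Suc j)"
      by presburger
    then have "q ^ (?e j + (2 * n + 1)) = (q ^ 2) ^ (m + n - j) * q ^ ?e (Suc j)"
      by (simp only: power_add power_mult)
    then show "?g (m + n) j * z ^ Suc j * w ^ m * q ^ (?e j + (2 * n + 1)) =
      (q ^ 2) ^ (m + n - j) * ?g (m + n) j * z ^ Suc j * w ^ m * q ^ ?e (Suc j)"
      by (simp only: ac_simps)
  qed
  also have "(\<Sum>j\<le>Suc (m+n). ?g (m + n) j * z ^ j * w ^ m * q ^ ?e j) + \<dots> =
      (\<Sum>j\<le>Suc (m+n). ?g (Suc (m + n)) j * z ^ j * w ^ m * q ^ ?e j)"
    unfolding sum.atMost_Suc_shift by (simp add: sum.distrib distrib_right)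
  finally show ?case by simp
qed

section \<open>The Bailey lemma and its iteration\<close>

text \<open>
  A terminating form of Cauchy's identity \<open>(\<Sum>s. q\<^bsup>s\<^sup>2\<^esup> x\<^sup>s / ((q;q)\<^sub>s (xq;q)\<^sub>s)) = 1 / (xq;q)\<^sub>\<infinity>\<close>. In the induction step the
  \<open>q\<close>-Pascal rule splits the sum for \<open>m + 1\<close> into \<open>1 - x * q ^ Suc m\<close> times the sum for \<open>x\<close> and
  \<open>x * q ^ Suc m\<close> times the sum for \<open>x * q\<close>; the two weights add up to 1.
\<close>

lemma finite_cauchy_identity:
  fixes q x :: "'a::comm_ring_1"
  shows "(\<Sum>s\<le>m. q ^ s ^ 2 * x ^ s * gauss_binom q m s * qpoch (x * q ^ Suc s) q (m - s)) = 1"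
proof (induction m arbitrary: x)
  case (Suc m)
  let ?g = "gauss_binom q"
  have "(\<Sum>s\<le>Suc m. q ^ s ^ 2 * x ^ s * ?g (Suc m) s * qpoch (x * q ^ Suc s) q (Suc m - s)) =
     (\<Sum>s\<le>Suc m. q ^ s ^ 2 * x ^ s * ?g m s * qpoch (x * q ^ Suc s) q (Suc m - s)) +
     (\<Sum>s\<le>m. q ^ Suc s ^ 2 * x ^ Suc s * (q ^ (m - s) * ?g m s) * qpoch (x * q ^ Suc (Suc s)) q (m - s))"
    unfolding sum.atMost_Suc_shift by (simp add: sum.distrib algebra_simps)
  also have "(\<Sum>s\<le>Suc m. q ^ s ^ 2 * x ^ s * ?g m s * qpoch (x * q ^ Suc s) q (Suc m - s)) =
     (\<Sum>s\<le>m. (1 - x * q ^ Suc m) * (q ^ s ^ 2 * x ^ s * ?g m s * qpoch (x * q ^ Suc s) q (m - s)))"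
  proof -
    have "qpoch (x * q ^ Suc s) q (Suc m - s) = (1 - x * q ^ Suc m) * qpoch (x * q ^ Suc s) q (m - s)"
      if "s \<le> m" for s
    proof -
      have "q ^ Suc s * q ^ (m - s) = q ^ Suc m"
        using that by (simp flip: power_add del: power_Suc)
      then have "x * q ^ Suc s * q ^ (m - s) = x * q ^ Suc m"
        by (simp only: mult.assoc)
      then show ?thesis
        using that by (simp add: Suc_diff_le qpoch_Suc mult.commute del: power_Suc)
    qed
    then show ?thesis
      by (simp add: gauss_binom_eq_0 mult_ac)
  qed
  also have "(\<Sum>s\<le>m. q ^ Suc s ^ 2 * x ^ Suc s * (q ^ (m - s) * ?g m s) * qpoch (x * q ^ Suc (Suc s)) q (m - s)) =
     (\<Sum>s\<le>m. (x * q ^ Suc m) * (q ^ s ^ 2 * (x * q) ^ s * ?g m s * qpoch (x * q * q ^ Suc s) q (m - s)))"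
  proof (intro sum.cong refl)
    fix s assume "s \<in> {..m}"
    then have "Suc s ^ 2 + (m - s) = Suc m + (s ^ 2 + s)"
      by (simp add: power2_eq_square)
    then have e: "q ^ Suc s ^ 2 * q ^ (m - s) = q ^ Suc m * q ^ s ^ 2 * q ^ s"
      by (metis power_add mult.assoc)
    have "q ^ Suc s ^ 2 * x ^ Suc s * (q ^ (m - s) * ?g m s) * qpoch (x * q ^ Suc (Suc s)) q (m - s)
       = (q ^ Suc s ^ 2 * q ^ (m - s)) * x ^ Suc s * ?g m s * qpoch (x * q ^ Suc (Suc s)) q (m - s)"
      by (simp only: ac_simps)
    also have "\<dots> = (x * q ^ Suc m) * (q ^ s ^ 2 * (x * q) ^ s * ?g m s * qpoch (x * q * q ^ Suc s) q (m - s))"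
      unfolding e by (simp add: power_mult_distrib ac_simps)
    finally show "q ^ Suc s ^ 2 * x ^ Suc s * (q ^ (m - s) * ?g m s) * qpoch (x * q ^ Suc (Suc s)) q (m - s)
       = (x * q ^ Suc m) * (q ^ s ^ 2 * (x * q) ^ s * ?g m s * qpoch (x * q * q ^ Suc s) q (m - s))" .
  qed
  finally show ?case
    unfolding sum_distrib_left[symmetric] Suc by simp
qed simp

text \<open>
  The Bailey lemma is linear in \<open>\<alpha>\<close>; this is the part of it that belongs to a single coefficient
  \<open>\<alpha> r\<close>. After clearing the inverses it is \<open>finite_cauchy_identity\<close> at \<open>x = q ^ (2 * r)\<close>.
\<close>

lemma bailey_kernel:
  fixes q :: "'a::comm_ring_1"
  assumes V: "\<And>n. qpoch q q n * V n = 1"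
  shows "(\<Sum>s\<le>m. q ^ (r + s) ^ 2 * V (m - s) * V s * V (2 * r + s)) = q ^ r ^ 2 * V m * V (2 * r + m)"
proof -
  let ?x = "q ^ (2 * r)"
  have "q ^ (r + s) ^ 2 * V (m - s) * V s * V (2 * r + s) =
      q ^ r ^ 2 * V m * V (2 * r + m) *
        (q ^ s ^ 2 * ?x ^ s * gauss_binom q m s * qpoch (?x * q ^ Suc s) q (m - s))"
    if s: "s \<le> m" for s
  proof -
    have e: "q ^ (r + s) ^ 2 = q ^ r ^ 2 * q ^ s ^ 2 * ?x ^ s"
    proof -
      have "(r + s) ^ 2 = r ^ 2 + s ^ 2 + 2 * r * s"
        by (simp add: power2_sum)
      then show ?thesis by (simp only: power_add power_mult)
    qed
    have "qpoch q q (2 * r + m) = qpoch q q (2 * r + s) * qpoch (?x * q ^ Suc s) q (m - s)"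
      using s qpoch_add[of q q "2 * r + s" "m - s"] by (simp add: power_add ac_simps)
    then have "V (2 * r + s) * (qpoch q q (2 * r + m) * V (2 * r + m)) =
        (qpoch q q (2 * r + s) * V (2 * r + s)) * (V (2 * r + m) * qpoch (?x * q ^ Suc s) q (m - s))"
      by (simp only: ac_simps)
    then have p: "V (2 * r + s) = V (2 * r + m) * qpoch (?x * q ^ Suc s) q (m - s)"
      by (simp only: V mult_1_left mult_1_right)
    have g: "V (m - s) * V s = V m * gauss_binom q m s"
    proof -
      have "V m * gauss_binom q m s = (qpoch q q m * V m) * (V (m - s) * V s)"
        unfolding gauss_binom_eq_inverses[OF V s] by (simp only: ac_simps)
      then show ?thesis by (simp add: V)
    qed
    have "q ^ (r + s) ^ 2 * V (m - s) * V s * V (2 * r + s) = q ^ (r + s) ^ 2 * (V (m - s) * V s) * V (2 * r + s)"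
      by (simp only: ac_simps)
    then show ?thesis
      unfolding g e p by (simp only: ac_simps)
  qed
  then have "(\<Sum>s\<le>m. q ^ (r + s) ^ 2 * V (m - s) * V s * V (2 * r + s)) =
    q ^ r ^ 2 * V m * V (2 * r + m) *
       (\<Sum>s\<le>m. q ^ s ^ 2 * ?x ^ s * gauss_binom q m s * qpoch (?x * q ^ Suc s) q (m - s))"
    by (simp add: sum_distrib_left)
  then show ?thesis by (simp only: finite_cauchy_identity mult_1_right)
qed

text \<open>
  The Bailey lemma with parameter \<open>a = 1\<close>: if \<open>\<beta> N\<close> is the inner sum on the left, then weighting \<open>\<beta> N\<close>
  by \<open>q ^ N\<^sup>2 / (q;q)\<^sub>M\<^sub>-\<^sub>N\<close> gives a sum of the same shape, in which \<open>\<alpha> r\<close> has picked up the factor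
  \<open>q ^ r\<^sup>2\<close>. This is what makes iteration possible.
\<close>

lemma bailey_lemma:
  fixes q :: "'a::comm_ring_1"
  assumes V: "\<And>n. qpoch q q n * V n = 1"
  shows "(\<Sum>N\<le>M. q ^ N ^ 2 * V (M - N) * (\<Sum>r\<le>N. \<alpha> r * V (N - r) * V (N + r))) =
    (\<Sum>r\<le>M. q ^ r ^ 2 * \<alpha> r * V (M - r) * V (M + r))"
proof -
  have "(\<Sum>N\<le>M. q ^ N ^ 2 * V (M - N) * (\<Sum>r\<le>N. \<alpha> r * V (N - r) * V (N + r))) =
     (\<Sum>(N,r)\<in>(SIGMA N:{..M}. {..N}). q ^ N ^ 2 * V (M - N) * (\<alpha> r * V (N - r) * V (N + r)))"
    by (simp add: sum_distrib_left sum.Sigma)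
  also have "\<dots> = (\<Sum>(r,s)\<in>(SIGMA r:{..M}. {..M - r}).
       \<alpha> r * (q ^ (r + s) ^ 2 * V (M - r - s) * V s * V (2 * r + s)))"
    by (rule sum.reindex_bij_witness[where i = "\<lambda>(r,s). (r + s, r)" and j = "\<lambda>(N,r). (r, N - r)"])
       (auto simp: ac_simps mult_2)
  also have "\<dots> = (\<Sum>r\<le>M. \<alpha> r * (\<Sum>s\<le>M - r. q ^ (r + s) ^ 2 * V (M - r - s) * V s * V (2 * r + s)))"
    by (simp add: sum_distrib_left sum.Sigma)
  also have "\<dots> = (\<Sum>r\<le>M. q ^ r ^ 2 * \<alpha> r * V (M - r) * V (M + r))"
    unfolding bailey_kernel[OF V] by (intro sum.cong refl) (simp add: mult_2 ac_simps)
  finally show ?thesis .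
qed

lemma finite_tail_bounded: "finite {n \<in> {i..k} \<rightarrow>\<^sub>E UNIV. tail_sum k n i \<le> M}"
proof (rule finite_subset)
  show "finite ({i..k} \<rightarrow>\<^sub>E {..M})" by (intro finite_PiE) auto
  show "{n \<in> {i..k} \<rightarrow>\<^sub>E UNIV. tail_sum k n i \<le> M} \<subseteq> {i..k} \<rightarrow>\<^sub>E {..M}"
  proof clarify
    fix n :: "nat \<Rightarrow> nat" assume n: "n \<in> {i..k} \<rightarrow>\<^sub>E UNIV" "tail_sum k n i \<le> M"
    have "n l \<le> M" if "l \<in> {i..k}" for l
      using member_le_sum[of l "{i..k}" n] that n by (simp add: tail_sum_def)
    then show "n \<in> {i..k} \<rightarrow>\<^sub>E {..M}" using n by (auto simp: PiE_iff)
  qed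
qed

lemma tail_sum_rec: "i \<le> k \<Longrightarrow> tail_sum k n i = n i + tail_sum k n (Suc i)"
  by (simp add: tail_sum_def sum.atLeast_Suc_atMost)

lemma tail_sum_cong: "(\<And>l. i \<le> l \<Longrightarrow> l \<le> k \<Longrightarrow> n l = m l) \<Longrightarrow> tail_sum k n i = tail_sum k m i"
  unfolding tail_sum_def by (intro sum.cong) auto

text \<open>
  Iterating the Bailey lemma once for every summation variable. In the variables \<open>N\<^sub>i = n\<^sub>i + \<dots> + n\<^sub>k\<close>
  the multisum is a nest of sums over \<open>N\<^sub>k \<le> \<dots> \<le> N\<^sub>i \<le> M\<close>, and \<open>n\<^sub>i = N\<^sub>i - N\<^sub>i\<^sub>+\<^sub>1\<close>, so that the factor
  \<open>V (n i)\<close> is exactly the weight that the Bailey lemma wants in the sum over \<open>N\<^sub>i\<^sub>+\<^sub>1\<close>.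
  The induction removes the outermost variable \<open>n\<^sub>i\<close>.
\<close>

lemma bailey_chain:
  fixes q :: "'a::comm_ring_1"
  assumes V: "\<And>n. qpoch q q n * V n = 1"
    and \<beta>: "\<And>n. \<beta> n = (\<Sum>r\<le>n. \<alpha> r * V (n - r) * V (n + r))"
    and "i \<le> k"
  shows "(\<Sum>n | n \<in> {i..k} \<rightarrow>\<^sub>E UNIV \<and> tail_sum k n i \<le> M.
       q ^ (\<Sum>l=i..k. (tail_sum k n l)\<^sup>2) * (\<Prod>l=i..<k. V (n l)) * \<beta> (n k) * V (M - tail_sum k n i)) =
     (\<Sum>r\<le>M. q ^ ((Suc k - i) * r\<^sup>2) * \<alpha> r * V (M - r) * V (M + r))"
  using assms(3)
proof (induction i arbitrary: M rule: inc_induct)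
  case base
  have "(\<Sum>n | n \<in> {k..k} \<rightarrow>\<^sub>E UNIV \<and> tail_sum k n k \<le> M.
       q ^ (\<Sum>l=k..k. (tail_sum k n l)\<^sup>2) * (\<Prod>l=k..<k. V (n l)) * \<beta> (n k) * V (M - tail_sum k n k)) =
      (\<Sum>N\<le>M. q ^ N ^ 2 * V (M - N) * \<beta> N)"
    by (rule sum.reindex_bij_witness[where i = "\<lambda>N l. if l = k then N else undefined" and j = "\<lambda>n. n k"])
       (auto simp: tail_sum_def PiE_iff extensional_def fun_eq_iff)
  also have "\<dots> = (\<Sum>r\<le>M. q ^ r ^ 2 * \<alpha> r * V (M - r) * V (M + r))"
    unfolding \<beta> by (rule bailey_lemma[OF V])
  finally show ?case
    by simp
next
  case (step i)
  let ?S = "\<lambda>i M. {n. n \<in> {i..k} \<rightarrow>\<^sub>E UNIV \<and> tail_sum k n i \<le> M}"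
  let ?t = "\<lambda>i M n. q ^ (\<Sum>l=i..k. (tail_sum k n l)\<^sup>2) * (\<Prod>l=i..<k. V (n l)) * \<beta> (n k) * V (M - tail_sum k n i)"
  \<comment> \<open>The outer variable \<open>n i\<close> is traded for \<open>N = tail_sum k n i\<close>; functions on \<open>{Suc i..k}\<close> take the
    value \<open>undefined\<close> at \<open>i\<close>.\<close>
  have "(\<Sum>n\<in>?S i M. ?t i M n) =
     (\<Sum>(N,n)\<in>(SIGMA N:{..M}. ?S (Suc i) N). q ^ N ^ 2 * V (M - N) * ?t (Suc i) N n)"
  proof (rule sum.reindex_bij_witness[where
        i = "\<lambda>(N,n). n(i := N - tail_sum k n (Suc i))" and
        j = "\<lambda>n. (tail_sum k n i, n(i := undefined))"])
    fix n assume n: "n \<in> ?S i M"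
    have ts: "tail_sum k (n(i := undefined)) l = tail_sum k n l" if "Suc i \<le> l" for l
      using that by (intro tail_sum_cong) auto
    have rec: "tail_sum k n i = n i + tail_sum k n (Suc i)"
      using step.hyps by (simp add: tail_sum_rec)
    show "(case (tail_sum k n i, n(i := undefined)) of (N, n) \<Rightarrow> n(i := N - tail_sum k n (Suc i))) = n"
      by (simp add: ts rec)
    show "(tail_sum k n i, n(i := undefined)) \<in> (SIGMA N:{..M}. ?S (Suc i) N)"
      using n by (auto simp: ts rec PiE_iff extensional_def)
    have "(\<Sum>l=i..k. (tail_sum k n l)\<^sup>2) = (tail_sum k n i)\<^sup>2 + (\<Sum>l=Suc i..k. (tail_sum k n l)\<^sup>2)"
      using step.hyps by (simp add: sum.atLeast_Suc_atMost)
    moreover have "(\<Prod>l=i..<k. V (n l)) = V (n i) * (\<Prod>l=Suc i..<k. V (n l))"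
      using step.hyps by (simp add: prod.atLeast_Suc_lessThan)
    moreover have "(\<Prod>l=Suc i..<k. V ((n(i := undefined)) l)) = (\<Prod>l=Suc i..<k. V (n l))"
      by (intro prod.cong) auto
    moreover have "(\<Sum>l=Suc i..k. (tail_sum k (n(i := undefined)) l)\<^sup>2) = (\<Sum>l=Suc i..k. (tail_sum k n l)\<^sup>2)"
      by (intro sum.cong) (auto simp: ts)
    ultimately show "(case (tail_sum k n i, n(i := undefined)) of (N, n) \<Rightarrow> q ^ N ^ 2 * V (M - N) * ?t (Suc i) N n) = ?t i M n"
      using step.hyps by (simp add: ts rec power_add ac_simps)
  next
    fix b assume b: "b \<in> (SIGMA N:{..M}. ?S (Suc i) N)"
    obtain N n where Nn: "b = (N, n)" by (cases b)
    have ts: "tail_sum k (n(i := x)) (Suc i) = tail_sum k n (Suc i)" for x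
      by (intro tail_sum_cong) auto
    have ui: "n i = undefined" using b Nn by (auto simp: PiE_iff extensional_def)
    have N: "tail_sum k (n(i := N - tail_sum k n (Suc i))) i = N"
      using step.hyps b Nn by (simp add: tail_sum_rec[of i] ts)
    show "(case b of (N, n) \<Rightarrow> n(i := N - tail_sum k n (Suc i))) \<in> ?S i M"
      using b step.hyps by (auto simp: Nn N PiE_iff extensional_def)
    show "(tail_sum k (case b of (N, n) \<Rightarrow> n(i := N - tail_sum k n (Suc i))) i,
         (case b of (N, n) \<Rightarrow> n(i := N - tail_sum k n (Suc i)))(i := undefined)) = b"
      by (simp add: Nn N) (metis fun_upd_triv ui)
  qed
  also have "\<dots> = (\<Sum>N\<le>M. q ^ N ^ 2 * V (M - N) * (\<Sum>n\<in>?S (Suc i) N. ?t (Suc i) N n))"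
    using finite_tail_bounded by (simp add: sum_distrib_left sum.Sigma)
  also have "\<dots> = (\<Sum>N\<le>M. q ^ N ^ 2 * V (M - N) *
       (\<Sum>r\<le>N. (q ^ ((k - i) * r\<^sup>2) * \<alpha> r) * V (N - r) * V (N + r)))"
    using step.IH by simp
  also have "\<dots> = (\<Sum>r\<le>M. q ^ r ^ 2 * (q ^ ((k - i) * r\<^sup>2) * \<alpha> r) * V (M - r) * V (M + r))"
    by (rule bailey_lemma[OF V])
  also have "\<dots> = (\<Sum>r\<le>M. q ^ ((Suc k - i) * r\<^sup>2) * \<alpha> r * V (M - r) * V (M + r))"
    using step.hyps by (simp add: Suc_diff_le power_add ac_simps)
  finally show ?case .
qed

section \<open>Infinite products in complete normed domains\<close>

text \<open>
  The setting in which the limit \<open>M \<rightarrow> \<infinity>\<close> is taken. It covers the complex numbers with their absolute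
  value and, with the same proofs, formal power series over a field with the \<open>X\<close>-adic absolute value
  \<open>f \<mapsto> dist f 0\<close>. In the second case there is no scalar multiplication compatible with the absolute value,
  so the type classes for normed algebras do not apply; the few facts on limits that are needed
  are derived from the inequalities.
\<close>

locale complete_normed_idom =
  fixes nm :: "'a::{idom_divide,inverse,metric_space} \<Rightarrow> real"
  assumes dist_eq_nm: "dist x y = nm (x - y)"
    and nm_mult: "nm (x * y) \<le> nm x * nm y"
    and nm_1 [simp]: "nm 1 = 1"
    and Cauchy_imp_convergent: "Cauchy X \<Longrightarrow> convergent (X :: nat \<Rightarrow> 'a)"
    and is_unit_1_minus: "nm x < 1 \<Longrightarrow> (1 - x) dvd 1"
begin

lemma nm_0 [simp]: "nm 0 = 0"
  using dist_eq_nm[of 0 0] by simp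

lemma nm_nonneg [simp]: "0 \<le> nm x"
  using dist_eq_nm[of x 0] zero_le_dist[of x 0] by simp

lemma nm_minus_commute: "nm (x - y) = nm (y - x)"
  by (simp add: dist_commute flip: dist_eq_nm)

lemma nm_uminus [simp]: "nm (- x) = nm x"
  using nm_minus_commute[of 0 x] by simp

lemma nm_add: "nm (x + y) \<le> nm x + nm y"
  using dist_triangle[of x "- y" 0] by (simp add: dist_eq_nm)

lemma nm_diff: "nm (x - y) \<le> nm x + nm y"
  using nm_add[of x "- y"] by simp

lemma nm_sum: "nm (\<Sum>x\<in>F. f x) \<le> (\<Sum>x\<in>F. nm (f x))"
proof (induction F rule: infinite_finite_induct)
  case (insert x F)
  then show ?case using nm_add[of "f x" "sum f F"] by simp
qed simp_all

lemma nm_mult_le: "nm x \<le> a \<Longrightarrow> nm y \<le> b \<Longrightarrow> nm (x * y) \<le> a * b"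
  by (rule order_trans[OF nm_mult mult_mono]) (auto intro: order_trans[OF nm_nonneg])

lemma nm_power: "nm (x ^ n) \<le> nm x ^ n"
  by (induction n) (auto intro: nm_mult_le)

lemma nm_prod_le: "(\<And>x. x \<in> F \<Longrightarrow> nm (f x) \<le> g x) \<Longrightarrow> nm (\<Prod>x\<in>F. f x) \<le> (\<Prod>x\<in>F. g x)"
  by (induction F rule: infinite_finite_induct) (auto intro: nm_mult_le)

lemma tendsto_iff_nm: "(X \<longlongrightarrow> L) F \<longleftrightarrow> ((\<lambda>n. nm (X n - L)) \<longlongrightarrow> 0) F"
  unfolding tendsto_dist_iff[of X] dist_eq_nm ..

lemma tendsto_by_nm_bound:
  fixes X :: "'b \<Rightarrow> 'a"
  assumes "(h \<longlongrightarrow> 0) F" "\<And>n. nm (X n - L) \<le> h n"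
  shows "(X \<longlongrightarrow> L) F"
  unfolding tendsto_iff_nm
proof (rule tendsto_sandwich[OF _ _ tendsto_const assms(1)])
  show "\<forall>\<^sub>F n in F. 0 \<le> nm (X n - L)" "\<forall>\<^sub>F n in F. nm (X n - L) \<le> h n"
    by (simp_all add: assms(2) always_eventually)
qed

lemma tendsto_mult_nm:
  fixes X Y :: "'b \<Rightarrow> 'a"
  assumes "(X \<longlongrightarrow> L) F" "(Y \<longlongrightarrow> M) F"
  shows "((\<lambda>n. X n * Y n) \<longlongrightarrow> L * M) F"
proof -
  let ?h = "\<lambda>n. nm (X n - L) * nm (Y n - M) + nm (X n - L) * nm M + nm L * nm (Y n - M)"
  have "(?h \<longlongrightarrow> 0 * 0 + 0 * nm M + nm L * 0) F"
    using assms unfolding tendsto_iff_nm by (intro tendsto_intros)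
  moreover have "nm (X n * Y n - L * M) \<le> ?h n" for n
  proof -
    have "X n * Y n - L * M = (X n - L) * (Y n - M) + (X n - L) * M + L * (Y n - M)"
      by (simp add: algebra_simps)
    then have "nm (X n * Y n - L * M) \<le> nm ((X n - L) * (Y n - M)) + nm ((X n - L) * M) + nm (L * (Y n - M))"
      using nm_add[of "(X n - L) * (Y n - M) + (X n - L) * M" "L * (Y n - M)"]
        nm_add[of "(X n - L) * (Y n - M)" "(X n - L) * M"] by simp
    also have "\<dots> \<le> ?h n"
      by (intro add_mono nm_mult)
    finally show ?thesis .
  qed
  ultimately show ?thesis
    by (intro tendsto_by_nm_bound[where h = ?h]) simp_all
qed

lemma tendsto_prod_nm:
  fixes X :: "'i \<Rightarrow> 'b \<Rightarrow> 'a"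
  shows "(\<And>i. i \<in> I \<Longrightarrow> (X i \<longlongrightarrow> L i) F) \<Longrightarrow> ((\<lambda>n. \<Prod>i\<in>I. X i n) \<longlongrightarrow> (\<Prod>i\<in>I. L i)) F"
  by (induction I rule: infinite_finite_induct) (auto intro: tendsto_mult_nm)

text \<open>
  The convergence criterion behind all infinite products here. A relative increment
  \<open>C * \<rho> ^ n\<close> keeps \<open>y\<close> bounded, since the product of \<open>1 + C * \<rho> ^ n\<close> converges; being bounded,
  \<open>y\<close> has geometrically small absolute increments.
\<close>

lemma geometric_growth_convergent:
  assumes step: "\<And>n. nm (y (Suc n) - y n) \<le> C * \<rho> ^ n * nm (y n)"
    and C: "0 \<le> C" and \<rho>: "0 \<le> \<rho>" "\<rho> < 1"
  shows "convergent y" and "\<exists>B. \<forall>n. nm (y n) \<le> B"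
proof -
  have grow: "nm (y n) \<le> nm (y 0) * exp (C * (\<Sum>i<n. \<rho> ^ i))" for n
  proof (induction n)
    case (Suc n)
    have "nm (y (Suc n)) \<le> nm (y n) + C * \<rho> ^ n * nm (y n)"
      using nm_add[of "y n" "y (Suc n) - y n"] step[of n] by simp
    also have "\<dots> = nm (y n) * (1 + C * \<rho> ^ n)"
      by (simp add: algebra_simps)
    also have "\<dots> \<le> (nm (y 0) * exp (C * (\<Sum>i<n. \<rho> ^ i))) * exp (C * \<rho> ^ n)"
      using C \<rho> by (intro mult_mono Suc exp_ge_add_one_self add_nonneg_nonneg mult_nonneg_nonneg) auto
    finally show ?case
      by (simp add: algebra_simps exp_add)
  qed simp
  define B where "B = nm (y 0) * exp (C * (1 / (1 - \<rho>)))"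
  have geo: "(\<Sum>i<n. \<rho> ^ i) \<le> 1 / (1 - \<rho>)" for n
    using \<rho> by (simp add: sum_gp_strict divide_right_mono)
  have B: "nm (y n) \<le> B" for n
    unfolding B_def exp_le_cancel_iff
    using C geo by (intro order_trans[OF grow] mult_left_mono iffD2[OF exp_le_cancel_iff]) auto
  then show "\<exists>B. \<forall>n. nm (y n) \<le> B" by blast
  have "B \<ge> 0" using B nm_nonneg order_trans by blast
  let ?K = "C * B / (1 - \<rho>)"
  have far: "nm (y (m + d) - y m) \<le> ?K * (\<rho> ^ m - \<rho> ^ (m + d))" for m d
  proof (induction d)
    case (Suc d)
    have "nm (y (m + Suc d) - y m) \<le> nm (y (m + d) - y m) + nm (y (Suc (m + d)) - y (m + d))"
      using nm_add[of "y (m + d) - y m" "y (Suc (m + d)) - y (m + d)"] by simp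
    also have "\<dots> \<le> ?K * (\<rho> ^ m - \<rho> ^ (m + d)) + C * \<rho> ^ (m + d) * B"
      using C \<rho> by (intro add_mono Suc order_trans[OF step] mult_left_mono B) auto
    also have "\<dots> = ?K * (\<rho> ^ m - \<rho> ^ (m + Suc d))"
      using \<rho> by (simp add: field_simps)
    finally show ?case .
  qed simp
  have "?K \<ge> 0" using C \<rho> \<open>B \<ge> 0\<close> by simp
  have dist_le: "dist (y m) (y n) \<le> ?K * \<rho> ^ N" if "m \<ge> N" "n \<ge> N" for m n N
  proof -
    have "dist (y m) (y (m + d)) \<le> ?K * \<rho> ^ N" if "m \<ge> N" for m d
    proof -
      have "dist (y m) (y (m + d)) \<le> ?K * (\<rho> ^ m - \<rho> ^ (m + d))"
        using far[of m d] by (simp add: dist_eq_nm nm_minus_commute)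
      also have "\<dots> \<le> ?K * \<rho> ^ N"
        using \<open>?K \<ge> 0\<close> \<rho> that power_decreasing[of N m \<rho>]
        by (intro mult_left_mono) (auto intro: order_trans[of _ "\<rho> ^ m"])
      finally show ?thesis .
    qed
    from this[of m "n - m"] this[of n "m - n"] that show ?thesis
      by (cases "m \<le> n") (auto simp: dist_commute)
  qed
  have lim: "(\<lambda>N. ?K * \<rho> ^ N) \<longlonglongrightarrow> ?K * 0"
    using \<rho> by (intro tendsto_intros LIMSEQ_realpow_zero) auto
  have "Cauchy y"
  proof (rule metric_CauchyI)
    fix e :: real assume "e > 0"
    with lim have "\<forall>\<^sub>F N in sequentially. ?K * \<rho> ^ N < e"
      by (auto dest: order_tendstoD(2))
    then obtain N where "?K * \<rho> ^ N < e"
      by (auto simp: eventually_sequentially)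
    then show "\<exists>N. \<forall>m\<ge>N. \<forall>n\<ge>N. dist (y m) (y n) < e"
      using dist_le by (meson le_less_trans)
  qed
  then show "convergent y" by (rule Cauchy_imp_convergent)
qed

text \<open>
  The partial products and their inverses both satisfy \<open>geometric_growth_convergent\<close>. Passing to
  the limit in \<open>qpoch a p n * V n = 1\<close> shows that the infinite product is a unit, in particular
  nonzero, as the definition of an infinite product requires.
\<close>

lemma qpoch_limits:
  assumes a: "nm a < 1" and p: "nm p < 1"
  obtains V W B where
    "qpoch a p \<longlonglongrightarrow> qpoch_inf a p"
    "\<And>n. qpoch a p n * V n = 1" "V \<longlonglongrightarrow> W" "qpoch_inf a p * W = 1" "\<And>n. nm (V n) \<le> B"
proof -
  have ap: "nm (a * p ^ n) \<le> nm a * nm p ^ n" for n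
    by (intro nm_mult_le nm_power order_refl)
  have small: "nm (a * p ^ n) \<le> nm a" for n
    using p by (intro order_trans[OF ap] mult_left_le) (auto intro: power_le_one)
  have "\<exists>w. (1 - a * p ^ n) * w = 1" for n
    using is_unit_1_minus[of "a * p ^ n"] small[of n] a by (auto elim!: dvdE intro: sym)
  then obtain w where w: "(1 - a * p ^ n) * w n = 1" for n by metis
  have nm_w: "nm (w n) \<le> 1 / (1 - nm a)" for n
  proof -
    have "w n = 1 + a * p ^ n * w n" using w[of n] by (simp add: algebra_simps)
    then have "nm (w n) \<le> 1 + nm (a * p ^ n * w n)"
      using nm_add[of 1 "a * p ^ n * w n"] by simp
    also have "nm (a * p ^ n * w n) \<le> nm a * nm (w n)"
      using small by (intro nm_mult_le) auto
    finally show ?thesis using a by (simp add: field_simps)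
  qed
  define V where "V n = (\<Prod>i<n. w i)" for n
  have V: "qpoch a p n * V n = 1" for n
    unfolding qpoch_def V_def prod.distrib[symmetric] by (simp add: w)
  define C where "C = nm a / (1 - nm a)"
  have C: "C \<ge> 0" "nm a \<le> C" using a by (auto simp: C_def field_simps)
  have step1: "nm (qpoch a p (Suc n) - qpoch a p n) \<le> C * nm p ^ n * nm (qpoch a p n)" for n
  proof -
    have "qpoch a p (Suc n) - qpoch a p n = - (a * p ^ n * qpoch a p n)"
      by (simp add: qpoch_Suc algebra_simps)
    then have "nm (qpoch a p (Suc n) - qpoch a p n) \<le> nm a * nm p ^ n * nm (qpoch a p n)"
      using nm_mult_le[OF ap[of n] order_refl, of "qpoch a p n"] by simp
    also have "\<dots> \<le> C * nm p ^ n * nm (qpoch a p n)"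
      using C by (intro mult_right_mono) auto
    finally show ?thesis .
  qed
  have step2: "nm (V (Suc n) - V n) \<le> C * nm p ^ n * nm (V n)" for n
  proof -
    have "V n = (1 - a * p ^ n) * w n * V n" by (simp add: w)
    then have "V (Suc n) - V n = a * p ^ n * w n * V n"
      by (simp add: V_def algebra_simps)
    also have "nm \<dots> \<le> (nm a * nm p ^ n) * (1 / (1 - nm a)) * nm (V n)"
      by (intro nm_mult_le ap nm_w order_refl)
    finally show ?thesis by (simp add: C_def)
  qed
  note g1 = geometric_growth_convergent[OF step1 C(1) nm_nonneg p]
  note g2 = geometric_growth_convergent[OF step2 C(1) nm_nonneg p]
  obtain L where L: "qpoch a p \<longlonglongrightarrow> L" using g1(1) by (auto simp: convergent_def)
  obtain W where W: "V \<longlonglongrightarrow> W" using g2(1) by (auto simp: convergent_def)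
  obtain B where B: "\<And>n. nm (V n) \<le> B" using g2(2) by blast
  have "(\<lambda>n. qpoch a p n * V n) \<longlonglongrightarrow> L * W"
    by (intro tendsto_mult_nm L W)
  then have LW: "L * W = 1"
    using LIMSEQ_unique[of "\<lambda>n. 1" "L * W" 1] by (simp add: V)
  have "(\<lambda>n. \<Prod>i\<le>n. 1 - a * p ^ i) \<longlonglongrightarrow> L"
    using LIMSEQ_Suc[OF L] by (simp add: qpoch_def lessThan_Suc_atMost)
  with LW have "(\<lambda>i. 1 - a * p ^ i) has_prod L"
    by (auto simp: has_prod_def raw_has_prod_def)
  then have "qpoch_inf a p = L"
    unfolding qpoch_inf_def by (rule has_prod_unique[symmetric])
  then show ?thesis using that L V W LW B by blast
qed

lemma qpoch_tendsto: "nm a < 1 \<Longrightarrow> nm p < 1 \<Longrightarrow> qpoch a p \<longlonglongrightarrow> qpoch_inf a p"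
  by (rule qpoch_limits)

lemma qpoch_inf_is_unit: "nm a < 1 \<Longrightarrow> nm p < 1 \<Longrightarrow> qpoch_inf a p dvd 1"
  by (erule (1) qpoch_limits) (metis dvdI)

section \<open>Tannery's theorem\<close>

text \<open>
  Dominated convergence for sums with truncation: \<open>u M\<close> is a bounded family of weights, supported on the
  finite set \<open>E M\<close>, that tends pointwise to a constant \<open>L\<close>. Outside a large finite set \<open>F0\<close> both sums
  are small by domination, and on \<open>F0\<close> the weights are close to \<open>L\<close>. Comparing two finite sums
  directly, the estimate yields either limit from the other.
\<close>

lemma tannery_core:
  fixes f :: "'i \<Rightarrow> 'a" and u :: "nat \<Rightarrow> 'i \<Rightarrow> 'a"
  assumes h: "h summable_on A" and f: "\<And>x. x \<in> A \<Longrightarrow> nm (f x) \<le> h x"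
    and u: "\<And>M x. x \<in> A \<Longrightarrow> nm (u M x) \<le> B"
    and lim: "\<And>x. x \<in> A \<Longrightarrow> (\<lambda>M. u M x) \<longlonglongrightarrow> L"
    and E: "\<And>M. finite (E M)" "\<And>M. E M \<subseteq> A"
    and zero: "\<And>M x. x \<in> A \<Longrightarrow> x \<notin> E M \<Longrightarrow> u M x = 0"
    and e: "e > 0"
  obtains F0 M0 where "finite F0" "F0 \<subseteq> A"
    "\<And>F M. finite F \<Longrightarrow> F0 \<subseteq> F \<Longrightarrow> F \<subseteq> A \<Longrightarrow> M \<ge> M0 \<Longrightarrow>
       nm ((\<Sum>x\<in>F. f x) * L - (\<Sum>x\<in>E M. f x * u M x)) < e"
proof -
  define K where "K = max (max B (nm L)) 1"
  have K: "K > 0" "B \<le> K" "nm L \<le> K" by (auto simp: K_def)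
  have h0: "0 \<le> h x" if "x \<in> A" for x
    using f[OF that] nm_nonneg order_trans by blast
  obtain H where H: "(h has_sum H) A" using h by (auto simp: summable_on_def)
  define \<delta> where "\<delta> = e / (6 * K)"
  have \<delta>: "\<delta> > 0" using e K by (simp add: \<delta>_def)
  obtain F0 where F0: "finite F0" "F0 \<subseteq> A"
    "\<And>F. finite F \<Longrightarrow> F0 \<subseteq> F \<Longrightarrow> F \<subseteq> A \<Longrightarrow> dist (sum h F) H < \<delta>"
    using H \<delta> unfolding has_sum_def tendsto_iff eventually_finite_subsets_at_top by metis
  have tail: "sum h G \<le> 2 * \<delta>" if G: "finite G" "G \<subseteq> A" "F0 \<inter> G = {}" for G
  proof -
    have "dist (sum h F0) H < \<delta>" "dist (sum h (F0 \<union> G)) H < \<delta>"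
      using F0 G by auto
    then show ?thesis
      using sum.union_disjoint[OF F0(1) G(1) G(3), of h] by (auto simp: dist_real_def)
  qed
  have tail_nm: "nm (\<Sum>x\<in>G. f x * v x) \<le> 2 * \<delta> * K"
    if G: "finite G" "G \<subseteq> A" "F0 \<inter> G = {}" and v: "\<And>x. x \<in> G \<Longrightarrow> nm (v x) \<le> K" for G v
  proof -
    have "nm (\<Sum>x\<in>G. f x * v x) \<le> (\<Sum>x\<in>G. h x * K)"
      using G v f by (intro order_trans[OF nm_sum] sum_mono nm_mult_le) auto
    also have "\<dots> = sum h G * K" by (simp add: sum_distrib_right)
    also have "\<dots> \<le> 2 * \<delta> * K" using tail[OF G] K by (intro mult_right_mono) auto
    finally show ?thesis .
  qed
  have "(\<lambda>M. \<Sum>x\<in>F0. h x * nm (u M x - L)) \<longlonglongrightarrow> (\<Sum>x\<in>F0. h x * 0)"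
    using lim F0(2) unfolding tendsto_iff_nm by (intro tendsto_intros) auto
  then have "\<forall>\<^sub>F M in sequentially. (\<Sum>x\<in>F0. h x * nm (u M x - L)) < e / 3"
    using e by (intro order_tendstoD(2)) auto
  then obtain M0 where M0: "\<And>M. M \<ge> M0 \<Longrightarrow> (\<Sum>x\<in>F0. h x * nm (u M x - L)) < e / 3"
    by (auto simp: eventually_sequentially)
  show ?thesis
  proof (rule that[OF F0(1,2)])
    fix F M assume F: "finite F" "F0 \<subseteq> F" "F \<subseteq> A" and M: "M \<ge> M0"
    have "(\<Sum>x\<in>F. f x * L) = (\<Sum>x\<in>F0. f x * L) + (\<Sum>x\<in>F - F0. f x * L)"
      using F by (metis sum.subset_diff add.commute)
    moreover have "(\<Sum>x\<in>E M. f x * u M x) = (\<Sum>x\<in>F0. f x * u M x) + (\<Sum>x\<in>E M - F0. f x * u M x)"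
    proof -
      have "(\<Sum>x\<in>E M. f x * u M x) = (\<Sum>x\<in>F0 \<union> E M. f x * u M x)"
        using F0 E zero by (intro sum.mono_neutral_left) auto
      also have "\<dots> = (\<Sum>x\<in>F0. f x * u M x) + (\<Sum>x\<in>E M - F0. f x * u M x)"
        using F0 E by (subst Un_Diff_cancel[symmetric], intro sum.union_disjoint) auto
      finally show ?thesis .
    qed
    ultimately have split: "(\<Sum>x\<in>F. f x) * L - (\<Sum>x\<in>E M. f x * u M x) =
       (\<Sum>x\<in>F0. f x * (L - u M x)) + (\<Sum>x\<in>F - F0. f x * L) - (\<Sum>x\<in>E M - F0. f x * u M x)"
      unfolding sum_distrib_right right_diff_distrib sum_subtractf by simp
    have "nm (\<Sum>x\<in>F0. f x * (L - u M x)) \<le> (\<Sum>x\<in>F0. h x * nm (u M x - L))"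
      using F0 f by (intro order_trans[OF nm_sum] sum_mono nm_mult_le) (auto simp: nm_minus_commute)
    also have "\<dots> < e / 3" using M0 M by simp
    finally have 1: "nm (\<Sum>x\<in>F0. f x * (L - u M x)) < e / 3" .
    have 2: "nm (\<Sum>x\<in>F - F0. f x * L) \<le> 2 * \<delta> * K"
      using F K by (intro tail_nm) auto
    have 3: "nm (\<Sum>x\<in>E M - F0. f x * u M x) \<le> 2 * \<delta> * K"
      using E by (intro tail_nm order_trans[OF u K(2)]) auto
    have "2 * \<delta> * K = e / 3" using K by (simp add: \<delta>_def)
    with 1 2 3 show "nm ((\<Sum>x\<in>F. f x) * L - (\<Sum>x\<in>E M. f x * u M x)) < e"
      unfolding split
      using nm_diff[of "(\<Sum>x\<in>F0. f x * (L - u M x)) + (\<Sum>x\<in>F - F0. f x * L)" "\<Sum>x\<in>E M - F0. f x * u M x"]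
        nm_add[of "\<Sum>x\<in>F0. f x * (L - u M x)" "\<Sum>x\<in>F - F0. f x * L"]
      by linarith
  qed
qed

text \<open>
  This direction evaluates the theta series and the multisum: for both, a finite identity gives the limit of
  the truncated sums, whose terms carry weights with limit \<open>L\<close>.
\<close>

lemma tannery_has_sum:
  fixes f :: "'i \<Rightarrow> 'a" and u :: "nat \<Rightarrow> 'i \<Rightarrow> 'a"
  assumes h: "h summable_on A" and f: "\<And>x. x \<in> A \<Longrightarrow> nm (f x) \<le> h x"
    and u: "\<And>M x. x \<in> A \<Longrightarrow> nm (u M x) \<le> B"
    and lim: "\<And>x. x \<in> A \<Longrightarrow> (\<lambda>M. u M x) \<longlonglongrightarrow> L"
    and E: "\<And>M. finite (E M)" "\<And>M. E M \<subseteq> A"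
    and zero: "\<And>M x. x \<in> A \<Longrightarrow> x \<notin> E M \<Longrightarrow> u M x = 0"
    and s: "(\<lambda>M. \<Sum>x\<in>E M. f x * u M x) \<longlonglongrightarrow> s" and U: "L * U = 1"
  shows "(f has_sum s * U) A"
  unfolding has_sum_def tendsto_iff eventually_finite_subsets_at_top
proof (intro allI impI)
  fix e :: real assume e: "e > 0"
  define D where "D = nm U + 1"
  have D: "D > 0" "nm U < D" unfolding D_def using nm_nonneg[of U] by linarith+
  define \<epsilon> where "\<epsilon> = e / (2 * D)"
  have \<epsilon>: "\<epsilon> > 0" using e D by (simp add: \<epsilon>_def)
  obtain F0 M0 where F0: "finite F0" "F0 \<subseteq> A" and FM:
    "\<And>F M. finite F \<Longrightarrow> F0 \<subseteq> F \<Longrightarrow> F \<subseteq> A \<Longrightarrow> M \<ge> M0 \<Longrightarrow>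
       nm ((\<Sum>x\<in>F. f x) * L - (\<Sum>x\<in>E M. f x * u M x)) < \<epsilon>"
    using tannery_core[where f = f and u = u and E = E, OF h f u lim E zero \<epsilon>] by blast
  have "\<forall>\<^sub>F M in sequentially. dist (\<Sum>x\<in>E M. f x * u M x) s < \<epsilon>"
    using s \<epsilon> by (rule tendstoD)
  then obtain M1 where M1: "\<And>M. M \<ge> M1 \<Longrightarrow> nm ((\<Sum>x\<in>E M. f x * u M x) - s) < \<epsilon>"
    by (auto simp: eventually_sequentially dist_eq_nm)
  show "\<exists>X. finite X \<and> X \<subseteq> A \<and> (\<forall>F. finite F \<and> X \<subseteq> F \<and> F \<subseteq> A \<longrightarrow> dist (sum f F) (s * U) < e)"
  proof (intro exI[of _ F0] conjI F0 allI impI)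
    fix F assume F: "finite F \<and> F0 \<subseteq> F \<and> F \<subseteq> A"
    let ?M = "max M0 M1"
    have "nm (sum f F * L - s) \<le>
        nm (sum f F * L - (\<Sum>x\<in>E ?M. f x * u ?M x)) + nm ((\<Sum>x\<in>E ?M. f x * u ?M x) - s)"
      using nm_add[of "sum f F * L - (\<Sum>x\<in>E ?M. f x * u ?M x)" "(\<Sum>x\<in>E ?M. f x * u ?M x) - s"] by simp
    also have "\<dots> \<le> 2 * \<epsilon>"
      using FM[of F ?M] M1[of ?M] F by simp
    finally have le: "nm (sum f F * L - s) \<le> 2 * \<epsilon>" .
    have "sum f F - s * U = (sum f F * L - s) * U"
      using U by (simp add: algebra_simps)
    then have "nm (sum f F - s * U) \<le> 2 * \<epsilon> * nm U"
      using nm_mult_le[OF le order_refl] by simp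
    also have "\<dots> = e * (nm U / D)"
      by (simp add: \<epsilon>_def)
    also have "\<dots> < e * 1"
      using e D by (intro mult_strict_left_mono) auto
    finally show "dist (sum f F) (s * U) < e" by (simp add: dist_eq_nm)
  qed
qed

text \<open>
  This direction handles the right-hand side of the truncated multisum identity, a weighted theta series.
\<close>

lemma tannery_tendsto:
  fixes f :: "'i \<Rightarrow> 'a" and u :: "nat \<Rightarrow> 'i \<Rightarrow> 'a"
  assumes h: "h summable_on A" and f: "\<And>x. x \<in> A \<Longrightarrow> nm (f x) \<le> h x"
    and u: "\<And>M x. x \<in> A \<Longrightarrow> nm (u M x) \<le> B"
    and lim: "\<And>x. x \<in> A \<Longrightarrow> (\<lambda>M. u M x) \<longlonglongrightarrow> L"
    and E: "\<And>M. finite (E M)" "\<And>M. E M \<subseteq> A"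
    and zero: "\<And>M x. x \<in> A \<Longrightarrow> x \<notin> E M \<Longrightarrow> u M x = 0"
    and t: "(f has_sum t) A"
  shows "(\<lambda>M. \<Sum>x\<in>E M. f x * u M x) \<longlonglongrightarrow> t * L"
proof (rule tendstoI)
  fix e :: real assume "e > 0"
  then have e: "e / 2 > 0" by simp
  obtain F0 M0 where F0: "finite F0" "F0 \<subseteq> A" and FM:
    "\<And>F M. finite F \<Longrightarrow> F0 \<subseteq> F \<Longrightarrow> F \<subseteq> A \<Longrightarrow> M \<ge> M0 \<Longrightarrow>
       nm ((\<Sum>x\<in>F. f x) * L - (\<Sum>x\<in>E M. f x * u M x)) < e / 2"
    using tannery_core[where f = f and u = u and E = E, OF h f u lim E zero e] by blast
  have "((\<lambda>F. sum f F * L) \<longlongrightarrow> t * L) (finite_subsets_at_top A)"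
    using t unfolding has_sum_def by (intro tendsto_mult_nm tendsto_const)
  then obtain F1 where F1: "finite F1" "F1 \<subseteq> A"
    "\<And>F. finite F \<Longrightarrow> F1 \<subseteq> F \<Longrightarrow> F \<subseteq> A \<Longrightarrow> dist (sum f F * L) (t * L) < e / 2"
    using e unfolding tendsto_iff eventually_finite_subsets_at_top by metis
  have "dist (\<Sum>x\<in>E M. f x * u M x) (t * L) < e" if "M \<ge> M0" for M
  proof -
    have "dist (sum f (F0 \<union> F1) * L) (t * L) < e / 2"
      using F0 F1 by auto
    moreover have "dist (sum f (F0 \<union> F1) * L) (\<Sum>x\<in>E M. f x * u M x) < e / 2"
      unfolding dist_eq_nm using F0 F1 that by (intro FM) auto
    ultimately show ?thesis
      using dist_triangle3[of "\<Sum>x\<in>E M. f x * u M x" "t * L" "sum f (F0 \<union> F1) * L"] by linarith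
  qed
  then show "\<forall>\<^sub>F M in sequentially. dist (\<Sum>x\<in>E M. f x * u M x) (t * L) < e"
    by (auto simp: eventually_sequentially)
qed

end

section \<open>Dissections of \<open>q\<close>-shifted factorials\<close>

lemma qpoch_dissect: "qpoch a b (d * m) = (\<Prod>j<d. qpoch (a * b ^ j) (b ^ d) m)"
proof -
  have "qpoch a b (d * m) = (\<Prod>i<m. \<Prod>j\<in>{i * d..<i * d + d}. 1 - a * b ^ j)"
    unfolding qpoch_def prod.nat_group by (simp add: mult.commute)
  also have "\<dots> = (\<Prod>i<m. \<Prod>j<d. 1 - a * b ^ j * (b ^ d) ^ i)"
  proof (rule prod.cong[OF refl])
    fix i
    have "(\<Prod>j\<in>{i * d..<i * d + d}. 1 - a * b ^ j) = (\<Prod>j<d. 1 - a * b ^ (j + i * d))"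
      using prod.shift_bounds_nat_ivl[of "\<lambda>j. 1 - a * b ^ j" 0 "i * d" d]
      by (simp add: add.commute atLeast0LessThan)
    also have "\<dots> = (\<Prod>j<d. 1 - a * b ^ j * (b ^ d) ^ i)"
      by (simp add: power_add mult.assoc mult.commute[of i d] flip: power_mult)
    finally show "(\<Prod>j\<in>{i * d..<i * d + d}. 1 - a * b ^ j) = (\<Prod>j<d. 1 - a * b ^ j * (b ^ d) ^ i)" .
  qed
  also have "\<dots> = (\<Prod>j<d. qpoch (a * b ^ j) (b ^ d) m)"
    unfolding qpoch_def by (rule prod.swap)
  finally show ?thesis .
qed

lemma qpoch_mult_uminus: "qpoch a p n * qpoch (- a) p n = qpoch (a ^ 2) (p ^ 2) n"
  unfolding qpoch_def prod.distrib[symmetric]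
proof (intro prod.cong refl)
  fix i
  have "(1 - a * p ^ i) * (1 - - a * p ^ i) = 1 - (a * p ^ i) ^ 2"
    by (simp add: algebra_simps power2_eq_square)
  then show "(1 - a * p ^ i) * (1 - - a * p ^ i) = 1 - a ^ 2 * (p ^ 2) ^ i"
    by (simp add: power_mult_distrib mult.commute flip: power_mult)
qed

section \<open>The theta series at a cube root of unity\<close>

text \<open>
  \<open>theta_coeff r\<close> is \<open>\<omega>\<^sup>r + \<omega>\<^bsup>-r\<^esup>\<close> for \<open>r \<ge> 1\<close> and a primitive cube root of unity \<open>\<omega>\<close>; at \<open>r = 0\<close> it is 1 and
  not 2, because folding a sum over all integers about 0 counts the middle term once.
\<close>

definition theta_coeff :: "nat \<Rightarrow> int" where
  "theta_coeff r = (if r = 0 then 1 else if 3 dvd r then 2 else - 1)"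

lemma Legendre_3: "Legendre a 3 = (if a mod 3 = 0 then 0 else if a mod 3 = 1 then 1 else - 1)"
proof -
  have "QuadRes 3 a \<longleftrightarrow> a mod 3 \<noteq> 2"
  proof
    assume "QuadRes 3 a"
    then obtain y where "y ^ 2 mod 3 = a mod 3"
      by (auto simp: QuadRes_def cong_def)
    moreover have "y ^ 2 mod 3 = (y mod 3) ^ 2 mod 3"
      by (simp add: power_mod)
    moreover have "y mod 3 = 0 \<or> y mod 3 = 1 \<or> y mod 3 = 2"
      by presburger
    ultimately show "a mod 3 \<noteq> 2"
      by auto
  next
    assume "a mod 3 \<noteq> 2"
    then have "a mod 3 = 0 \<or> a mod 3 = 1"
      by presburger
    then show "QuadRes 3 a"
      unfolding QuadRes_def cong_def by (auto intro: exI[of _ 0] exI[of _ 1])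
  qed
  moreover have "[a = 0] (mod 3) \<longleftrightarrow> a mod 3 = 0"
    by (simp add: cong_def)
  moreover have "a mod 3 = 0 \<or> a mod 3 = 1 \<or> a mod 3 = 2"
    by presburger
  ultimately show ?thesis
    unfolding Legendre_def by auto
qed

text \<open>
  The even part of \<open>r \<mapsto> Legendre (r + 1) 3\<close> is the even part of \<open>r \<mapsto> \<omega>\<^sup>r\<close>. This is where the cube
  root of unity enters.
\<close>

lemma Legendre_fold: "r \<ge> 1 \<Longrightarrow> Legendre (1 - int r) 3 + Legendre (int r + 1) 3 = theta_coeff r"
proof -
  assume r: "r \<ge> 1"
  have m: "(1 - int r) mod 3 = (1 - int (r mod 3)) mod 3" "(int r + 1) mod 3 = (int (r mod 3) + 1) mod 3"
    by (simp_all add: zmod_int mod_simps)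
  consider "r mod 3 = 0" | "r mod 3 = 1" | "r mod 3 = 2" by linarith
  then show ?thesis
    unfolding Legendre_3 theta_coeff_def m dvd_eq_mod_eq_0 using r by cases simp_all
qed

lemma cube_root_power_sum:
  fixes z :: "'a::comm_ring_1"
  assumes z: "z * z + z + 1 = 0" and r: "r \<ge> 1"
  shows "z ^ r + (z * z) ^ r = of_int (theta_coeff r)"
proof -
  have "z * z * z - 1 = (z - 1) * (z * z + z + 1)"
    by (simp add: algebra_simps)
  then have z3: "z ^ 3 = 1" using z by (simp add: power3_eq_cube)
  have zz: "z * z = - z - 1"
    using z by (simp add: algebra_simps eq_neg_iff_add_eq_0)
  have red: "x ^ r = x ^ (r mod 3)" if "x ^ 3 = 1" for x :: 'a
  proof -
    have "x ^ r = (x ^ 3) ^ (r div 3) * x ^ (r mod 3)"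
      by (simp flip: power_mult power_add)
    then show ?thesis by (simp add: that)
  qed
  have "(z * z) ^ 3 = 1" by (simp add: power_mult_distrib z3)
  note red2 = red[OF this]
  consider "r mod 3 = 0" | "r mod 3 = 1" | "r mod 3 = 2" by linarith
  then show ?thesis
  proof cases
    case 1
    then show ?thesis unfolding red[OF z3] red2 using r by (simp add: theta_coeff_def dvd_eq_mod_eq_0)
  next
    case 2
    then show ?thesis unfolding red[OF z3] red2 using r by (simp add: theta_coeff_def dvd_eq_mod_eq_0 zz)
  next
    case 3
    have "z ^ 2 + (z * z) ^ 2 = z * z + z ^ 3 * z"
      by (simp add: power2_eq_square power3_eq_cube mult.assoc)
    with 3 show ?thesis unfolding red[OF z3] red2 using r by (simp add: theta_coeff_def dvd_eq_mod_eq_0 zz z3)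
  qed
qed

lemma sum_fold_about_middle:
  fixes f g :: "nat \<Rightarrow> 'a::comm_monoid_add"
  assumes "f M = g 0" and "\<And>r. 1 \<le> r \<Longrightarrow> r \<le> M \<Longrightarrow> f (M + r) + f (M - r) = g r"
  shows "(\<Sum>j\<le>2 * M. f j) = (\<Sum>r\<le>M. g r)"
proof -
  have "(\<Sum>j\<le>2 * M. f j) = f M + ((\<Sum>j<M. f j) + (\<Sum>j=Suc M..M + M. f j))"
  proof -
    have "{..2 * M} = insert M ({..<M} \<union> {Suc M..M + M})" by auto
    then show ?thesis
      by (subst sum.union_disjoint[symmetric]) auto
  qed
  also have "(\<Sum>j<M. f j) = (\<Sum>r=1..M. f (M - r))"
    by (rule sum.reindex_bij_witness[where i = "\<lambda>r. M - r" and j = "\<lambda>r. M - r"]) auto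
  also have "(\<Sum>j=Suc M..M + M. f j) = (\<Sum>r=1..M. f (M + r))"
    using sum.shift_bounds_cl_nat_ivl[of f 1 M M] by (simp add: add.commute)
  also have "f M + ((\<Sum>r=1..M. f (M - r)) + (\<Sum>r=1..M. f (M + r))) = g 0 + (\<Sum>r=1..M. g r)"
    using assms by (simp add: add.commute flip: sum.distrib)
  also have "\<dots> = (\<Sum>r\<le>M. g r)"
    by (simp add: atMost_atLeast0 sum.atLeast_Suc_atMost)
  finally show ?thesis .
qed

text \<open>
  Substituting \<open>j = n \<plusminus> r\<close> turns the inner sum over \<open>j\<close> into a \<open>\<beta>\<^sub>n\<close> of the form required by the Bailey
  lemma.
\<close>

lemma Legendre_sum_fold:
  fixes V :: "nat \<Rightarrow> 'a::comm_ring_1"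
  shows "(\<Sum>j\<le>2 * n. of_int (Legendre (int n - int j + 1) 3) * V (2 * n - j) * V j) =
    (\<Sum>r\<le>n. of_int (theta_coeff r) * V (n - r) * V (n + r))"
proof (rule sum_fold_about_middle)
  show "of_int (Legendre (int n - int n + 1) 3) * V (2 * n - n) * V n =
      of_int (theta_coeff 0) * V (n - 0) * V (n + 0)"
    by (simp add: Legendre_3 theta_coeff_def mult_2)
  fix r assume r: "1 \<le> r" "r \<le> n"
  have i: "2 * n - (n + r) = n - r" "2 * n - (n - r) = n + r" "int n - int (n + r) + 1 = 1 - int r"
    "int n - int (n - r) + 1 = int r + 1"
    using r by auto
  show "of_int (Legendre (int n - int (n + r) + 1) 3) * V (2 * n - (n + r)) * V (n + r) +
      of_int (Legendre (int n - int (n - r) + 1) 3) * V (2 * n - (n - r)) * V (n - r) =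
      of_int (theta_coeff r) * V (n - r) * V (n + r)"
    unfolding i by (simp add: algebra_simps flip: Legendre_fold[OF r(1)])
qed

text \<open>
  The finite triple product at \<open>z = \<omega>\<close>: the pair of factors with index \<open>i\<close> is
  \<open>(1 + \<omega> x) (1 + \<omega>\<^sup>2 x) = 1 - x + x\<^sup>2\<close> with \<open>x = q\<^bsup>2i+1\<^esup>\<close>, and the terms \<open>j = M \<plusminus> r\<close> combine to
  \<open>theta_coeff r\<close>.
\<close>

lemma finite_theta_product:
  fixes q z :: "'a::comm_ring_1"
  assumes z: "z * z + z + 1 = 0" and V: "\<And>n. qpoch (q ^ 2) (q ^ 2) n * V n = 1"
  shows "(\<Sum>r\<le>M. of_int (theta_coeff r) * q ^ r ^ 2 * (V (M - r) * V (M + r))) =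
     V (2 * M) * (\<Prod>i<M. 1 - q ^ (2 * i + 1) + (q ^ (2 * i + 1)) ^ 2)"
proof -
  let ?w = "z * z" and ?P = "qpoch (q ^ 2) (q ^ 2) (2 * M)"
  have "z * z * z - 1 = (z - 1) * (z * z + z + 1)"
    by (simp add: algebra_simps)
  then have zw: "z * ?w = 1" using z by (simp add: mult.assoc)
  have sum: "z + ?w = - 1"
    using z by (simp add: algebra_simps eq_neg_iff_add_eq_0)
  have zwp: "z ^ (a + b) * ?w ^ a = z ^ b" "z ^ a * ?w ^ (a + b) = ?w ^ b" for a b
  proof -
    have "z ^ a * ?w ^ a = 1" by (simp add: zw flip: power_mult_distrib)
    moreover have "z ^ (a + b) * ?w ^ a = z ^ b * (z ^ a * ?w ^ a)" "z ^ a * ?w ^ (a + b) = ?w ^ b * (z ^ a * ?w ^ a)"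
      by (simp_all only: power_add ac_simps)
    ultimately show "z ^ (a + b) * ?w ^ a = z ^ b" "z ^ a * ?w ^ (a + b) = ?w ^ b"
      by simp_all
  qed
  have "(\<Prod>i<M. 1 - q ^ (2 * i + 1) + (q ^ (2 * i + 1)) ^ 2) =
      (\<Prod>i<M. 1 + z * q ^ (2 * i + 1)) * (\<Prod>i<M. 1 + ?w * q ^ (2 * i + 1))"
    unfolding prod.distrib[symmetric]
  proof (intro prod.cong refl)
    fix i
    have "(1 + z * x) * (1 + ?w * x) = 1 + (z + ?w) * x + (z * ?w) * x ^ 2" for x
      by (simp add: algebra_simps power2_eq_square)
    then show "1 - q ^ (2 * i + 1) + (q ^ (2 * i + 1)) ^ 2 = (1 + z * q ^ (2 * i + 1)) * (1 + ?w * q ^ (2 * i + 1))"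
      unfolding sum zw by simp
  qed
  also have "\<dots> = (\<Sum>j\<le>2 * M. gauss_binom (q ^ 2) (2 * M) j * z ^ j * ?w ^ M * q ^ nat ((int j - int M) ^ 2))"
    using finite_triple_product[OF zw, where m = M and n = M and q = q] by (simp only: mult_2)
  also have "\<dots> = (\<Sum>r\<le>M. ?P * (of_int (theta_coeff r) * q ^ r ^ 2 * (V (M - r) * V (M + r))))"
  proof (rule sum_fold_about_middle)
    have "z ^ M * ?w ^ M = 1" using zwp(1)[of M 0] by simp
    moreover have "gauss_binom (q ^ 2) (2 * M) M = ?P * (V M * V M)"
      using gauss_binom_eq_inverses[OF V, of M "2 * M"] by (simp add: mult_2 mult.assoc)
    moreover have "gauss_binom (q ^ 2) (2 * M) M * z ^ M * ?w ^ M * q ^ nat ((int M - int M) ^ 2) =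
        gauss_binom (q ^ 2) (2 * M) M * (z ^ M * ?w ^ M)"
      by (simp only: mult.assoc) simp
    ultimately show "gauss_binom (q ^ 2) (2 * M) M * z ^ M * ?w ^ M * q ^ nat ((int M - int M) ^ 2) =
        ?P * (of_int (theta_coeff 0) * q ^ 0 ^ 2 * (V (M - 0) * V (M + 0)))"
      by (simp add: theta_coeff_def)
  next
    fix r assume r: "1 \<le> r" "r \<le> M"
    obtain d where d: "M = d + r" using r by (metis add.commute le_Suc_ex)
    have e: "nat ((int (M + r) - int M) ^ 2) = r ^ 2" "nat ((int (M - r) - int M) ^ 2) = r ^ 2"
      using r by (simp_all add: of_nat_diff nat_power_eq)
    have g: "gauss_binom (q ^ 2) (2 * M) (M + r) = ?P * (V (M - r) * V (M + r))"
      "gauss_binom (q ^ 2) (2 * M) (M - r) = ?P * (V (M - r) * V (M + r))"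
      using r gauss_binom_eq_inverses[OF V, of "M + r" "2 * M"] gauss_binom_eq_inverses[OF V, of "M - r" "2 * M"]
      by (simp_all add: mult_2 ac_simps)
    have zz: "z ^ (M + r) * ?w ^ M = z ^ r" "z ^ (M - r) * ?w ^ M = ?w ^ r"
      using zwp(1)[of M r] zwp(2)[of d r] by (simp_all add: d)
    have "gauss_binom (q ^ 2) (2 * M) (M + r) * z ^ (M + r) * ?w ^ M * q ^ nat ((int (M + r) - int M) ^ 2) +
      gauss_binom (q ^ 2) (2 * M) (M - r) * z ^ (M - r) * ?w ^ M * q ^ nat ((int (M - r) - int M) ^ 2) =
      ?P * (V (M - r) * V (M + r)) * q ^ r ^ 2 * (z ^ (M + r) * ?w ^ M + z ^ (M - r) * ?w ^ M)"
      unfolding e g by (simp only: distrib_left ac_simps)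
    also have "\<dots> = ?P * (of_int (theta_coeff r) * q ^ r ^ 2 * (V (M - r) * V (M + r)))"
      unfolding zz cube_root_power_sum[OF z r(1)] by (simp only: ac_simps)
    finally show "gauss_binom (q ^ 2) (2 * M) (M + r) * z ^ (M + r) * ?w ^ M * q ^ nat ((int (M + r) - int M) ^ 2) +
      gauss_binom (q ^ 2) (2 * M) (M - r) * z ^ (M - r) * ?w ^ M * q ^ nat ((int (M - r) - int M) ^ 2) =
      ?P * (of_int (theta_coeff r) * q ^ r ^ 2 * (V (M - r) * V (M + r)))" .
  qed
  finally have *: "(\<Prod>i<M. 1 - q ^ (2 * i + 1) + (q ^ (2 * i + 1)) ^ 2) =
      ?P * (\<Sum>r\<le>M. of_int (theta_coeff r) * q ^ r ^ 2 * (V (M - r) * V (M + r)))"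
    by (simp add: sum_distrib_left)
  have "V (2 * M) * (?P * S) = (?P * V (2 * M)) * S" for S
    by (simp only: ac_simps)
  then show ?thesis
    unfolding * by (simp only: V mult_1_left)
qed

text \<open>
  Multiplying \<open>1 - x + x\<^sup>2\<close> by \<open>1 + x\<close> gives \<open>1 + x\<^sup>3\<close>, and so a product of the form \<^const>\<open>qpoch\<close>.
\<close>

lemma prod_cyclotomic6_qpoch:
  "(\<Prod>i<M. 1 - q ^ (2 * i + 1) + (q ^ (2 * i + 1)) ^ 2) * qpoch (- q) (q ^ 2) M =
    qpoch (- (q ^ 3)) (q ^ 6) M"
  unfolding qpoch_def prod.distrib[symmetric]
proof (intro prod.cong refl)
  fix i
  have "q * (q ^ 2) ^ i = q ^ (2 * i + 1)"
    by (simp flip: power_mult)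
  moreover have "q ^ 3 * (q ^ 6) ^ i = (q ^ (2 * i + 1)) ^ 3"
    by (simp add: algebra_simps flip: power_mult power_add)
  moreover have "(1 - x + x ^ 2) * (1 + x) = 1 + x ^ 3" for x :: 'a
    by (simp add: algebra_simps power2_eq_square power3_eq_cube)
  ultimately show "(1 - q ^ (2 * i + 1) + (q ^ (2 * i + 1)) ^ 2) * (1 - - q * (q ^ 2) ^ i) =
      1 - - (q ^ 3) * (q ^ 6) ^ i"
    by simp
qed

section \<open>Evaluation of the theta series\<close>

context complete_normed_idom
begin

lemma nm_of_int_theta_coeff: "nm (of_int (theta_coeff r)) \<le> 2"
  using nm_add[of 1 1] by (auto simp: theta_coeff_def)

lemma nm_power_less_1: "nm q < 1 \<Longrightarrow> 0 < n \<Longrightarrow> nm (q ^ n) < 1"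
  by (rule le_less_trans[OF nm_power]) (auto intro: power_less_one_iff[THEN iffD2])

lemma qpoch_inf_dissect:
  assumes "nm a < 1" "nm b < 1" "d > 0"
  shows "qpoch_inf a b = (\<Prod>j<d. qpoch_inf (a * b ^ j) (b ^ d))"
proof (rule LIMSEQ_unique)
  have "strict_mono (\<lambda>m. d * m)" using assms(3) by (auto simp: strict_mono_def)
  then show "(\<lambda>m. qpoch a b (d * m)) \<longlonglongrightarrow> qpoch_inf a b"
    using LIMSEQ_subseq_LIMSEQ[OF qpoch_tendsto[OF assms(1,2)]] by (simp add: o_def)
  have "nm (a * b ^ j) < 1" for j
  proof -
    have "nm (a * b ^ j) \<le> nm a * 1"
      using assms(2) by (intro nm_mult_le order_trans[OF nm_power]) (auto intro: power_le_one)
    then show ?thesis using assms(1) by simp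
  qed
  then show "(\<lambda>m. qpoch a b (d * m)) \<longlonglongrightarrow> (\<Prod>j<d. qpoch_inf (a * b ^ j) (b ^ d))"
    unfolding qpoch_dissect using assms nm_power_less_1 by (intro tendsto_prod_nm qpoch_tendsto) auto
qed

lemma qpoch_inf_mult_uminus:
  assumes "nm a < 1" "nm p < 1"
  shows "qpoch_inf a p * qpoch_inf (- a) p = qpoch_inf (a ^ 2) (p ^ 2)"
proof (rule LIMSEQ_unique)
  show "(\<lambda>n. qpoch (a ^ 2) (p ^ 2) n) \<longlonglongrightarrow> qpoch_inf (a ^ 2) (p ^ 2)"
    using assms nm_power_less_1 by (intro qpoch_tendsto) auto
  show "(\<lambda>n. qpoch (a ^ 2) (p ^ 2) n) \<longlonglongrightarrow> qpoch_inf a p * qpoch_inf (- a) p"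
    unfolding qpoch_mult_uminus[symmetric] using assms by (intro tendsto_mult_nm qpoch_tendsto) auto
qed

text \<open>
  \<open>r\<^sup>2 \<ge> r\<close> suffices to dominate the theta series by a geometric series.
\<close>

lemma theta_terms_dominated:
  assumes q: "nm q < 1"
  shows "(\<lambda>r. 2 * nm q ^ r) summable_on UNIV" "nm (of_int (theta_coeff r) * q ^ r ^ 2) \<le> 2 * nm q ^ r"
proof -
  show "(\<lambda>r. 2 * nm q ^ r) summable_on UNIV"
    using q by (subst summable_on_UNIV_nonneg_real_iff) (auto intro: summable_mult summable_geometric)
  have "nm (q ^ r ^ 2) \<le> nm q ^ r"
    using q by (intro order_trans[OF nm_power] power_decreasing) (auto simp: power2_eq_square)
  then show "nm (of_int (theta_coeff r) * q ^ r ^ 2) \<le> 2 * nm q ^ r"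
    by (intro nm_mult_le nm_of_int_theta_coeff)
qed

lemma shifted_tendsto:
  fixes V :: "nat \<Rightarrow> 'a"
  assumes "V \<longlonglongrightarrow> W"
  shows "(\<lambda>M. if t \<le> M then V (M - t) else 0) \<longlonglongrightarrow> W"
    and "(\<lambda>M. if t \<le> M then V (M - t) * V (M + t) else 0) \<longlonglongrightarrow> W * W"
proof -
  have 1: "(\<lambda>M. V (M - t)) \<longlonglongrightarrow> W"
    by (rule LIMSEQ_offset[of _ t]) (simp add: assms)
  have ev: "\<forall>\<^sub>F M in sequentially. t \<le> M" by (rule eventually_ge_at_top)
  show "(\<lambda>M. if t \<le> M then V (M - t) else 0) \<longlonglongrightarrow> W"
    by (rule Lim_transform_eventually[OF 1]) (use ev in \<open>eventually_elim, simp\<close>)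
  show "(\<lambda>M. if t \<le> M then V (M - t) * V (M + t) else 0) \<longlonglongrightarrow> W * W"
    by (rule Lim_transform_eventually[OF tendsto_mult_nm[OF 1 LIMSEQ_ignore_initial_segment[OF assms, of t]]])
       (use ev in \<open>eventually_elim, simp\<close>)
qed

text \<open>
  In the finite theta identity the weights \<open>V (M - r) * V (M + r)\<close> tend to \<open>1/(q\<^sup>2;q\<^sup>2)\<^sub>\<infinity>\<^sup>2\<close>, so Tannery's
  theorem evaluates the theta series. The factor \<open>qpoch_inf (- q) (q ^ 2)\<close> stays on the left in order to
  keep the identity free of division.
\<close>

lemma theta_has_sum:
  fixes q z :: 'a
  assumes q: "nm q < 1" and z: "z * z + z + 1 = 0"
  obtains \<theta> where "((\<lambda>r. of_int (theta_coeff r) * q ^ r ^ 2) has_sum \<theta>) UNIV"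
    "\<theta> * qpoch_inf (- q) (q ^ 2) = qpoch_inf (q ^ 2) (q ^ 2) * qpoch_inf (- (q ^ 3)) (q ^ 6)"
proof -
  have q2: "nm (q ^ 2) < 1" and q3: "nm (- (q ^ 3)) < 1" and q6: "nm (q ^ 6) < 1" and q1: "nm (- q) < 1"
    using q nm_power_less_1 by simp_all
  obtain V W B where V: "\<And>n. qpoch (q ^ 2) (q ^ 2) n * V n = 1" "V \<longlonglongrightarrow> W"
      "qpoch_inf (q ^ 2) (q ^ 2) * W = 1" "\<And>n. nm (V n) \<le> B"
    using qpoch_limits[OF q2 q2] by metis
  obtain V' W' where V': "\<And>n. qpoch (- q) (q ^ 2) n * V' n = 1" "V' \<longlonglongrightarrow> W'"
      "qpoch_inf (- q) (q ^ 2) * W' = 1"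
    using qpoch_limits[OF q1 q2] by metis
  let ?P = "qpoch_inf (q ^ 2) (q ^ 2)" and ?R = "qpoch_inf (- (q ^ 3)) (q ^ 6)" and ?E = "qpoch_inf (- q) (q ^ 2)"
  let ?f = "\<lambda>r. of_int (theta_coeff r) * q ^ r ^ 2"
  let ?u = "\<lambda>M r. if r \<le> M then V (M - r) * V (M + r) else 0"
  have B: "B \<ge> 0" using V(4) nm_nonneg order_trans by blast
  have partial: "(\<Sum>r\<le>M. ?f r * ?u M r) = V (2 * M) * (qpoch (- (q ^ 3)) (q ^ 6) M * V' M)" for M
  proof -
    have "(\<Sum>r\<le>M. ?f r * ?u M r) = V (2 * M) * (\<Prod>i<M. 1 - q ^ (2 * i + 1) + (q ^ (2 * i + 1)) ^ 2)"
      unfolding finite_theta_product[OF z V(1), symmetric] by (intro sum.cong) auto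
    also have "(\<Prod>i<M. 1 - q ^ (2 * i + 1) + (q ^ (2 * i + 1)) ^ 2) =
        (\<Prod>i<M. 1 - q ^ (2 * i + 1) + (q ^ (2 * i + 1)) ^ 2) * (qpoch (- q) (q ^ 2) M * V' M)"
      unfolding V'(1) by simp
    also have "\<dots> = qpoch (- (q ^ 3)) (q ^ 6) M * V' M"
      by (simp only: mult.assoc[symmetric] prod_cyclotomic6_qpoch)
    finally show ?thesis .
  qed
  have "strict_mono (\<lambda>m::nat. 2 * m)" by (auto simp: strict_mono_def)
  then have "(\<lambda>M. V (2 * M)) \<longlonglongrightarrow> W"
    using LIMSEQ_subseq_LIMSEQ[OF V(2)] by (simp add: o_def)
  then have "(\<lambda>M. \<Sum>r\<le>M. ?f r * ?u M r) \<longlonglongrightarrow> W * (?R * W')"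
    unfolding partial by (intro tendsto_mult_nm V' qpoch_tendsto q3 q6)
  moreover have "nm (?u M r) \<le> B * B" for M r
    using V(4) B by (auto intro: nm_mult_le)
  moreover have "(W * W) * (?P * ?P) = 1"
  proof -
    have "(W * W) * (?P * ?P) = (?P * W) * (?P * W)" by (simp only: ac_simps)
    then show ?thesis by (simp add: V(3))
  qed
  ultimately have "(?f has_sum (W * (?R * W')) * (?P * ?P)) UNIV"
    using theta_terms_dominated[OF q] shifted_tendsto(2)[OF V(2)]
    by (intro tannery_has_sum[where u = ?u and E = "\<lambda>M. {..M}" and L = "W * W" and B = "B * B"]) auto
  moreover have "(W * (?R * W')) * (?P * ?P) * ?E = (?P * W) * (?E * W') * (?P * ?R)"
    by (simp only: ac_simps)
  then have "(W * (?R * W')) * (?P * ?P) * ?E = ?P * ?R"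
    by (simp add: V(3) V'(3))
  ultimately show ?thesis by (rule that)
qed

text \<open>
  Write \<open>P a b\<close> for \<open>(q\<^sup>a;q\<^sup>b)\<^sub>\<infinity>\<close>. Multiplication by \<open>P 1 2\<close> and \<open>P 3 6\<close> removes the two products with a
  negative argument, since \<open>(a;p)\<^sub>\<infinity> (-a;p)\<^sub>\<infinity> = (a\<^sup>2;p\<^sup>2)\<^sub>\<infinity>\<close>. Splitting the exponents into residue classes
  modulo 4, 6 and 12 then leaves \<open>P 2 4\<close> and \<open>P 3 6\<close> on both sides; they are nonzero.
\<close>

lemma theta_product_rearrange:
  assumes q: "nm q < 1"
    and \<theta>: "\<theta> * qpoch_inf (- q) (q ^ 2) = qpoch_inf (q ^ 2) (q ^ 2) * qpoch_inf (- (q ^ 3)) (q ^ 6)"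
  shows "\<theta> = qpochs_inf [q, q ^ 5, q ^ 6] (q ^ 6) * qpochs_inf [q ^ 4, q ^ 8] (q ^ 12)"
proof -
  define P where "P a b = qpoch_inf (q ^ a) (q ^ b)" for a b :: nat
  have n: "nm (q ^ a) < 1" if "a > 0" for a using q that by (rule nm_power_less_1)
  have nz: "P a b \<noteq> 0" if "a > 0" "b > 0" for a b
    using qpoch_inf_is_unit[OF n[OF that(1)] n[OF that(2)]] unfolding P_def by auto
  have dis: "P a b = (\<Prod>j<d. P (a + b * j) (b * d))" if "a > 0" "b > 0" "d > 0" for a b d
    using qpoch_inf_dissect[OF n[OF that(1)] n[OF that(2)] that(3)]
    by (simp add: P_def power_add power_mult)
  have d22: "P 2 2 = P 2 4 * P 4 4"
    using dis[of 2 2 2] by (simp add: numeral_eq_Suc)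
  have d44: "P 4 4 = P 4 12 * P 8 12 * P 12 12"
    using dis[of 4 4 3] by (simp add: lessThan_Suc eval_nat_numeral mult.commute)
  have d12: "P 1 2 = P 1 6 * P 3 6 * P 5 6"
    using dis[of 1 2 3] by (simp add: numeral_eq_Suc ac_simps)
  have d66: "P 6 6 = P 6 12 * P 12 12"
    using dis[of 6 6 2] by (simp add: numeral_eq_Suc)
  have m1: "P 1 2 * qpoch_inf (- q) (q ^ 2) = P 2 4"
    using qpoch_inf_mult_uminus[of q "q ^ 2"] q n by (simp add: P_def flip: power_mult)
  have m3: "P 3 6 * qpoch_inf (- (q ^ 3)) (q ^ 6) = P 6 12"
    using qpoch_inf_mult_uminus[of "q ^ 3" "q ^ 6"] n by (simp add: P_def flip: power_mult)
  have "\<theta> * (P 2 4 * P 3 6) = (\<theta> * qpoch_inf (- q) (q ^ 2)) * P 1 2 * P 3 6"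
    unfolding m1[symmetric] by (simp only: ac_simps)
  also have "\<dots> = P 2 2 * P 1 2 * (P 3 6 * qpoch_inf (- (q ^ 3)) (q ^ 6))"
    unfolding \<theta> P_def by (simp only: ac_simps)
  also have "\<dots> = (P 1 6 * P 5 6 * P 6 6 * (P 4 12 * P 8 12)) * (P 2 4 * P 3 6)"
    unfolding m3 d22 d44 d12 d66 by (simp only: ac_simps)
  finally have "\<theta> = P 1 6 * P 5 6 * P 6 6 * (P 4 12 * P 8 12)"
    using nz[of 2 4] nz[of 3 6] by simp
  then show ?thesis
    by (simp add: P_def qpochs_inf_def mult.assoc)
qed

end

section \<open>Summability over index vectors\<close>

lemma summable_on_prod_PiE:
  fixes g :: "nat \<Rightarrow> real"
  assumes I: "finite I" and g: "\<And>m. 0 \<le> g m" "summable g"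
  shows "(\<lambda>n. \<Prod>l\<in>I. g (n l)) summable_on (I \<rightarrow>\<^sub>E UNIV)"
proof (rule nonneg_bounded_partial_sums_imp_summable_on[where C = "suminf g ^ card I"])
  show "0 \<le> (\<Prod>l\<in>I. g (n l))" for n
    by (intro prod_nonneg) (simp add: g)
  show "\<forall>\<^sub>F X in finite_subsets_at_top (I \<rightarrow>\<^sub>E UNIV). (\<Sum>n\<in>X. \<Prod>l\<in>I. g (n l)) \<le> suminf g ^ card I"
  proof (rule eventually_finite_subsets_at_top_weakI)
    fix X :: "('a \<Rightarrow> nat) set" assume X: "finite X" "X \<subseteq> I \<rightarrow>\<^sub>E UNIV"
    define m where "m = Max (\<Union>n\<in>X. n ` I)"
    have "X \<subseteq> I \<rightarrow>\<^sub>E {..m}"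
    proof
      fix n assume n: "n \<in> X"
      have "n l \<le> m" if "l \<in> I" for l
        unfolding m_def using X I n that by (intro Max_ge) auto
      then show "n \<in> I \<rightarrow>\<^sub>E {..m}" using n X by (auto simp: PiE_iff)
    qed
    then have "(\<Sum>n\<in>X. \<Prod>l\<in>I. g (n l)) \<le> (\<Sum>n\<in>I \<rightarrow>\<^sub>E {..m}. \<Prod>l\<in>I. g (n l))"
      using I by (intro sum_mono2 finite_PiE prod_nonneg) (auto simp: g)
    also have "\<dots> = (\<Prod>l\<in>I. \<Sum>j\<le>m. g j)"
      using I by (intro prod_sum_PiE[symmetric]) auto
    also have "\<dots> \<le> (\<Prod>l\<in>I. suminf g)"
      using g by (intro prod_mono conjI sum_nonneg sum_le_suminf) auto
    finally show "(\<Sum>n\<in>X. \<Prod>l\<in>I. g (n l)) \<le> suminf g ^ card I" by simp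
  qed
qed

section \<open>The multisum\<close>

context complete_normed_idom
begin

lemma divide_by_unit: "u * v = 1 \<Longrightarrow> x div u = x * v" for u v x :: 'a
proof -
  assume uv: "u * v = 1"
  then have "u \<noteq> 0" by auto
  have "x = (x * v) * u" using uv by (simp add: ac_simps)
  then show ?thesis using nonzero_mult_div_cancel_right[OF \<open>u \<noteq> 0\<close>, of "x * v"] by (simp only:)
qed

lemma multisum_inner:
  fixes q :: 'a
  assumes V: "\<And>n. qpoch q q n * V n = 1"
  shows "(\<Sum>j=0..2 * n k. multisum_term k q n j) =
    q ^ (\<Sum>i=1..k. (tail_sum k n i)\<^sup>2) * (\<Prod>i=1..<k. V (n i)) *
      (\<Sum>r\<le>n k. of_int (theta_coeff r) * V (n k - r) * V (n k + r))"
proof -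
  have "multisum_term k q n j = q ^ (\<Sum>i=1..k. (tail_sum k n i)\<^sup>2) * (\<Prod>i=1..<k. V (n i)) *
      (of_int (Legendre (int (n k) - int j + 1) 3) * V (2 * n k - j) * V j)" for j
  proof -
    have "(\<Prod>i=1..<k. qpoch q q (n i)) * (\<Prod>i=1..<k. V (n i)) = 1"
      by (simp add: V flip: prod.distrib)
    moreover have "(qpoch q q (2 * n k - j) * (\<Prod>i=1..<k. qpoch q q (n i)) * qpoch q q j) *
        (V (2 * n k - j) * (\<Prod>i=1..<k. V (n i)) * V j) =
        (qpoch q q (2 * n k - j) * V (2 * n k - j)) * (qpoch q q j * V j) *
        ((\<Prod>i=1..<k. qpoch q q (n i)) * (\<Prod>i=1..<k. V (n i)))"
      by (simp only: ac_simps)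
    ultimately have "(qpoch q q (2 * n k - j) * (\<Prod>i=1..<k. qpoch q q (n i)) * qpoch q q j) *
        (V (2 * n k - j) * (\<Prod>i=1..<k. V (n i)) * V j) = 1"
      by (simp only: V mult_1_left)
    then show ?thesis
      unfolding multisum_term_def by (subst divide_by_unit) (assumption, simp only: ac_simps)
  qed
  then show ?thesis
    unfolding Legendre_sum_fold[where V = V and n = "n k", symmetric]
    unfolding sum_distrib_left atMost_atLeast0
    by simp
qed

text \<open>
  A dominating function that is a product over the coordinates, hence summable over all index vectors:
  \<open>N\<^sub>i\<^sup>2 \<ge> N\<^sub>i \<ge> n\<^sub>i\<close> bounds the power of \<open>q\<close>, the inverses \<open>1/(q;q)\<^sub>n\<close> are uniformly bounded, and the
  \<open>n\<^sub>k + 1\<close> terms of the inner sum are bounded by the product of all \<open>n\<^sub>l + 1\<close>.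
\<close>

lemma nm_multisum_inner_le:
  fixes q :: 'a and V :: "nat \<Rightarrow> 'a"
  assumes q: "nm q < 1" and V: "\<And>n. nm (V n) \<le> B" and k: "1 \<le> k"
  shows "nm (q ^ (\<Sum>i=1..k. (tail_sum k n i)\<^sup>2) * (\<Prod>i=1..<k. V (n i)) *
      (\<Sum>r\<le>n k. of_int (theta_coeff r) * V (n k - r) * V (n k + r))) \<le>
    (B ^ (k - 1) * (2 * B * B)) * (\<Prod>l=1..k. real (Suc (n l)) * nm q ^ n l)"
proof -
  have B: "0 \<le> B" using V nm_nonneg order_trans by blast
  have "nm (q ^ (\<Sum>i=1..k. (tail_sum k n i)\<^sup>2)) \<le> nm q ^ (\<Sum>l=1..k. n l)"
  proof -
    have "n l \<le> (tail_sum k n l)\<^sup>2" if "l \<in> {1..k}" for l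
    proof -
      have "n l \<le> tail_sum k n l"
        unfolding tail_sum_def using that by (intro member_le_sum) auto
      also have "\<dots> \<le> (tail_sum k n l)\<^sup>2" by (simp add: power2_eq_square)
      finally show ?thesis .
    qed
    then have "(\<Sum>l=1..k. n l) \<le> (\<Sum>i=1..k. (tail_sum k n i)\<^sup>2)"
      by (rule sum_mono)
    then show ?thesis
      using q by (intro order_trans[OF nm_power] power_decreasing) auto
  qed
  moreover have "nm (\<Prod>i=1..<k. V (n i)) \<le> B ^ (k - 1)"
    using nm_prod_le[of "{1..<k}" "\<lambda>i. V (n i)" "\<lambda>_. B"] V by simp
  moreover have "nm (\<Sum>r\<le>n k. of_int (theta_coeff r) * V (n k - r) * V (n k + r)) \<le> 2 * B * B * (\<Prod>l=1..k. real (Suc (n l)))"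
  proof -
    have "nm (\<Sum>r\<le>n k. of_int (theta_coeff r) * V (n k - r) * V (n k + r)) \<le> (\<Sum>r\<le>n k. 2 * B * B)"
      by (intro order_trans[OF nm_sum] sum_mono nm_mult_le nm_of_int_theta_coeff V)
    also have "\<dots> = 2 * B * B * real (Suc (n k))"
      by simp
    also have "\<dots> \<le> 2 * B * B * (\<Prod>l=1..k. real (Suc (n l)))"
    proof -
      have "(\<Prod>l=1..k. real (Suc (n l))) = real (Suc (n k)) * (\<Prod>l\<in>{1..k} - {k}. real (Suc (n l)))"
        using k by (intro prod.remove) auto
      moreover have "1 \<le> (\<Prod>l\<in>{1..k} - {k}. real (Suc (n l)))"
        by (intro prod_ge_1) auto
      ultimately have "real (Suc (n k)) \<le> (\<Prod>l=1..k. real (Suc (n l)))"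
        using mult_left_mono[of 1 "\<Prod>l\<in>{1..k} - {k}. real (Suc (n l))" "real (Suc (n k))"] by simp
      then show ?thesis using B by (intro mult_left_mono) auto
    qed
    finally show ?thesis .
  qed
  ultimately have "nm (q ^ (\<Sum>i=1..k. (tail_sum k n i)\<^sup>2) * (\<Prod>i=1..<k. V (n i)) *
      (\<Sum>r\<le>n k. of_int (theta_coeff r) * V (n k - r) * V (n k + r))) \<le>
    nm q ^ (\<Sum>l=1..k. n l) * B ^ (k - 1) * (2 * B * B * (\<Prod>l=1..k. real (Suc (n l))))"
    by (intro nm_mult_le)
  also have "\<dots> = (B ^ (k - 1) * (2 * B * B)) * (\<Prod>l=1..k. real (Suc (n l)) * nm q ^ n l)"
    by (simp add: power_sum prod.distrib)
  finally show ?thesis .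
qed

text \<open>
  In the truncated identity \<open>bailey_chain\<close> the right-hand side is a weighted theta series in \<open>q\<^sup>k\<close>; its
  limit is \<open>\<theta> / (q;q)\<^sub>\<infinity>\<^sup>2\<close>. The weights on the left tend to \<open>1/(q;q)\<^sub>\<infinity>\<close>, so the multisum itself is
  \<open>\<theta> / (q;q)\<^sub>\<infinity>\<close>.
\<close>

theorem multisum_has_sum:
  fixes q z :: 'a
  assumes q: "nm q < 1" and z: "z * z + z + 1 = 0" and k: "1 \<le> k"
  shows "((\<lambda>n. \<Sum>j=0..2 * n k. multisum_term k q n j) has_sum product_side k q) ({1..k} \<rightarrow>\<^sub>E UNIV)"
proof -
  obtain V W B where V: "\<And>n. qpoch q q n * V n = 1" "V \<longlonglongrightarrow> W" "qpoch_inf q q * W = 1" "\<And>n. nm (V n) \<le> B"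
    using qpoch_limits[OF q q] by metis
  have B: "0 \<le> B" using V(4) nm_nonneg order_trans by blast
  have qk: "nm (q ^ k) < 1" using q k by (intro nm_power_less_1) auto
  let ?\<alpha> = "\<lambda>r. of_int (theta_coeff r) :: 'a"
  let ?A = "{1..k} \<rightarrow>\<^sub>E (UNIV :: nat set)"
  define f where "f n = q ^ (\<Sum>i=1..k. (tail_sum k n i)\<^sup>2) * (\<Prod>i=1..<k. V (n i)) *
      (\<Sum>r\<le>n k. ?\<alpha> r * V (n k - r) * V (n k + r))" for n
  obtain \<theta> where \<theta>: "((\<lambda>r. ?\<alpha> r * (q ^ k) ^ r ^ 2) has_sum \<theta>) UNIV"
    "\<theta> * qpoch_inf (- (q ^ k)) ((q ^ k) ^ 2) = qpoch_inf ((q ^ k) ^ 2) ((q ^ k) ^ 2) * qpoch_inf (- ((q ^ k) ^ 3)) ((q ^ k) ^ 6)"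
    by (rule theta_has_sum[OF qk z])
  let ?E = "\<lambda>M. {n. n \<in> ?A \<and> tail_sum k n 1 \<le> M}"
  let ?u = "\<lambda>M n. if tail_sum k n 1 \<le> M then V (M - tail_sum k n 1) else 0"
  let ?v = "\<lambda>M r. if r \<le> M then V (M - r) * V (M + r) else 0"
  have partial: "(\<Sum>n\<in>?E M. f n * ?u M n) = (\<Sum>r\<le>M. ?\<alpha> r * (q ^ k) ^ r ^ 2 * ?v M r)" for M
  proof -
    have "(\<Sum>n\<in>?E M. f n * ?u M n) = (\<Sum>n\<in>?E M. q ^ (\<Sum>l=1..k. (tail_sum k n l)\<^sup>2) * (\<Prod>l=1..<k. V (n l)) *
        (\<Sum>r\<le>n k. ?\<alpha> r * V (n k - r) * V (n k + r)) * V (M - tail_sum k n 1))"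
      by (intro sum.cong refl) (simp add: f_def)
    also have "\<dots> = (\<Sum>r\<le>M. q ^ ((Suc k - 1) * r\<^sup>2) * ?\<alpha> r * V (M - r) * V (M + r))"
      by (rule bailey_chain[OF V(1) refl k])
    also have "\<dots> = (\<Sum>r\<le>M. ?\<alpha> r * (q ^ k) ^ r ^ 2 * ?v M r)"
    proof (intro sum.cong refl)
      fix r assume "r \<in> {..M}"
      then have "?v M r = V (M - r) * V (M + r)" by simp
      moreover have "q ^ ((Suc k - 1) * r\<^sup>2) = (q ^ k) ^ r ^ 2" by (simp add: power_mult)
      ultimately show "q ^ ((Suc k - 1) * r\<^sup>2) * ?\<alpha> r * V (M - r) * V (M + r) = ?\<alpha> r * (q ^ k) ^ r ^ 2 * ?v M r"
        by (simp only: ac_simps)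
    qed
    finally show ?thesis .
  qed
  have "(\<lambda>M. \<Sum>r\<le>M. ?\<alpha> r * (q ^ k) ^ r ^ 2 * ?v M r) \<longlonglongrightarrow> \<theta> * (W * W)"
    using theta_terms_dominated[OF qk] shifted_tendsto(2)[OF V(2)] \<theta>(1) V(4) B
    by (intro tannery_tendsto[where u = ?v and E = "\<lambda>M. {..M}" and L = "W * W" and B = "B * B"])
       (auto intro: nm_mult_le)
  then have lim: "(\<lambda>M. \<Sum>n\<in>?E M. f n * ?u M n) \<longlonglongrightarrow> \<theta> * (W * W)"
    by (simp only: partial)
  have summ: "(\<lambda>n. (B ^ (k - 1) * (2 * B * B)) * (\<Prod>l=1..k. real (Suc (n l)) * nm q ^ n l)) summable_on ?A"
  proof (intro summable_on_cmult_right summable_on_prod_PiE)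
    show "summable (\<lambda>m. real (Suc m) * nm q ^ m)"
      using geometric_deriv_sums[of "nm q"] q by (auto simp: sums_iff)
  qed auto
  have "(f has_sum \<theta> * (W * W) * qpoch_inf q q) ?A"
  proof (rule tannery_has_sum[where u = ?u and E = ?E and L = W and B = B, OF summ])
    show "nm (f n) \<le> (B ^ (k - 1) * (2 * B * B)) * (\<Prod>l=1..k. real (Suc (n l)) * nm q ^ n l)" for n
      unfolding f_def by (rule nm_multisum_inner_le[OF q V(4) k])
    show "nm (?u M n) \<le> B" for M n using V(4) B by simp
    show "(\<lambda>M. ?u M n) \<longlonglongrightarrow> W" for n by (rule shifted_tendsto(1)[OF V(2)])
    show "finite (?E M)" for M by (rule finite_tail_bounded)
    show "?E M \<subseteq> ?A" for M by blast
    show "?u M n = 0" if "n \<in> ?A" "n \<notin> ?E M" for M n using that by simp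
    show "W * qpoch_inf q q = 1" using V(3) by (simp add: mult.commute)
  qed (rule lim)
  moreover have "\<theta> * (W * W) * qpoch_inf q q = product_side k q"
  proof -
    have "product_side k q = \<theta> div qpoch_inf q q"
      unfolding product_side_def theta_product_rearrange[OF qk \<theta>(2)] by (simp add: mult.commute flip: power_mult)
    also have "\<dots> = \<theta> * W" by (rule divide_by_unit[OF V(3)])
    also have "\<dots> = \<theta> * W * (qpoch_inf q q * W)" by (simp add: V(3))
    finally show ?thesis by (simp only: ac_simps)
  qed
  moreover have "(\<lambda>n. \<Sum>j=0..2 * n k. multisum_term k q n j) = f"
    unfolding f_def by (intro ext multisum_inner V)
  ultimately show ?thesis by simp
qed

end

section \<open>Complex numbers and formal power series\<close>

interpretation complex_norm: complete_normed_idom "norm :: complex \<Rightarrow> real"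
proof
  show "norm x < 1 \<Longrightarrow> 1 - x dvd 1" for x :: complex
    by (auto simp: dvd_field_iff)
qed (auto simp: dist_norm norm_mult Cauchy_convergent)

text \<open>
  In a Cauchy sequence every coefficient is eventually constant; the eventual values form the limit.
\<close>

lemma fps_Cauchy_imp_convergent:
  fixes X :: "nat \<Rightarrow> 'a::field fps"
  assumes "Cauchy X"
  shows "convergent X"
proof -
  have "\<exists>N. \<forall>m\<ge>N. fps_nth (X m) n = fps_nth (X N) n" for n
  proof -
    obtain N where N: "\<And>m. m \<ge> N \<Longrightarrow> dist (X m) (X N) < inverse (2 ^ n)"
      using metric_CauchyD[OF assms, of "inverse (2 ^ n)"] by auto
    have "fps_nth (X m) n = fps_nth (X N) n" if m: "m \<ge> N" for m
    proof (cases "X m = X N")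
      case False
      with N[OF m] have "n < subdegree (X m - X N)"
        by (simp add: dist_fps_def)
      then have "fps_nth (X m - X N) n = 0"
        by (rule nth_less_subdegree_zero)
      then show ?thesis by simp
    qed simp
    then show ?thesis by blast
  qed
  then obtain N where N: "\<And>n m. m \<ge> N n \<Longrightarrow> fps_nth (X m) n = fps_nth (X (N n)) n"
    by metis
  have "X \<longlonglongrightarrow> Abs_fps (\<lambda>n. fps_nth (X (N n)) n)"
    by (rule tendsto_fpsI) (auto simp: eventually_sequentially intro: N)
  then show ?thesis by (auto simp: convergent_def)
qed

interpretation fps_norm: complete_normed_idom "\<lambda>f :: complex fps. dist f 0"
proof
  show "dist (f * g) 0 \<le> dist f 0 * dist g 0" for f g :: "complex fps"
    by (simp add: dist_fps_def power_add)
  show "dist f 0 < 1 \<Longrightarrow> 1 - f dvd 1" for f :: "complex fps"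
  proof -
    assume "dist f 0 < 1"
    then have "fps_nth f 0 = 0"
      by (cases "f = 0") (auto simp: dist_fps_def subdegree_eq_0_iff intro: ccontr split: if_splits)
    then show "1 - f dvd 1" by simp
  qed
qed (auto simp: dist_fps_def fps_Cauchy_imp_convergent)

theorem theorem3p6:
  fixes k :: nat
  assumes "k \<ge> 1"
  shows "((\<lambda>n. \<Sum>j=0..2 * n k. multisum_term k (fps_X :: complex fps) n j)
            has_sum product_side k fps_X) ({1..k} \<rightarrow>\<^sub>E UNIV) \<and>
         (\<forall>q::complex. norm q < 1 \<longrightarrow>
            ((\<lambda>n. \<Sum>j=0..2 * n k. multisum_term k q n j)
               has_sum product_side k q) ({1..k} \<rightarrow>\<^sub>E UNIV))"
proof -
  \<comment> \<open>A primitive cube root of unity; as a constant it also serves for power series.\<close>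
  define z where "z = Complex (- 1 / 2) (sqrt 3 / 2)"
  have z: "z * z + z + 1 = 0"
    by (simp add: z_def complex_eq_iff)
  have "fps_const z * fps_const z + fps_const z + 1 = fps_const (z * z + z + 1)"
    by (simp flip: fps_const_1_eq_1)
  then have "fps_const z * fps_const z + fps_const z + 1 = 0"
    by (simp add: z)
  moreover have "dist (fps_X :: complex fps) 0 < 1"
    by (simp add: dist_fps_def)
  ultimately show ?thesis
    using fps_norm.multisum_has_sum complex_norm.multisum_has_sum[OF _ z] assms by blast
qed

end
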